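(* Let $(\eta,\nu,X)$ be a (Kang-Ramanan) measure-valued fluid model tracking elapsed times with input data $(\lambda(\cdot),\eta_0,\nu_0,X(0))$ such that $(\eta_0,\nu_0,X(0))\in\mathcal S_0$. Suppose that $\eta_0$ and $\nu_0$ have densities $\tilde q(0,x)$ and $b(0,x)$, respectively. Then the pair $(B(t,y),Q(t,y))$ given, together with $\tilde Q(t,y)$, by $$B(t,y)=\nu_t[0,y],\qquad \tilde Q(t,y)=\eta_t[0,y],\qquad Q(t,y)=\eta_t[0,y\wedge\chi(t)],\qquad t,y\ge0,$$ is a (Whitt) two-parameter fluid model tracking elapsed times with input data $(\lambda(\cdot),\tilde q(0,x),b(0,x))$ and $q(0,x)=\tilde q(0,x)$.
   Context: **Primitives.** $\lambda(\cdot)\ge 0$ is the arrival rate function on $[0,\infty)$ and $E(t)=\int_0^t\lambda(s)\,ds$. $G^s$ and $G^r$ are the service and patience time distribution functions, with $G^s(0+)=G^r(0+)=0$; $\bar G^s=1-G^s$, $\bar G^r=1-G^r$; $H^r=\inf\{x\in\mathbb R_+:G^r(x)=1\}$, $H^s=\inf\{x\in\mathbb R_+:G^s(x)=1\}$. It is assumed that $G^s,G^r$ have densities $g^s,g^r$ on $[0,\infty)$; the hazard rates are $h^r=g^r/\bar G^r$ on $[0,H^r)$ and $h^s=g^s/\bar G^s$ on $[0,H^s)$. $\mathcal C_b(\mathbb R_+)$ is the set of bounded continuous real functions on $\mathbb R_+=[0,\infty)$; $a\wedge b=\min(a,b)$, $a^+=[a]^+=\max(a,0)$. **The set $\mathcal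 S_0$** consists of triples $(\eta,\nu,x)$ with $\eta$ a nonnegative finite measure on $[0,\infty)$ with support in $[0,H^r)$, $\nu$ a nonnegative finite measure on $[0,\infty)$ with support in $[0,H^s)$, $x\in\mathbb R_+$, $1-\nu[0,H^s)=[1-x]^+$ and $\nu[0,H^s)+\eta[0,H^r)=x$. **Kang-Ramanan's measure-valued fluid model.** For each $t$, $\eta_t$ and $\nu_t$ are nonnegative finite measures on $[0,\infty)$ with supports in $[0,H^r)$ and $[0,H^s)$ respectively. The triple $(\eta,\nu,X)$ is a measure-valued fluid model tracking elapsed times with input data $(\lambda(\cdot),\eta_0,\nu_0,X(0))$, $(\eta_0,\nu_0,X(0))\in\mathcal S_0$, if for every $\psi\in\mathcal C_b(\mathbb R_+)$ and $t\ge0$: $$\int_0^\infty\psi(x)\eta_t(dx)=\int_{[0,H^r)}\psi(x+t)\tfrac{\bar G^r(x+t)}{\bar G^r(x)}\eta_0(dx)+\int_0^t\psi(t-s)\bar G^r(t-s)\lambda(s)ds,$$ $$\int_0^\infty\psi(x)\nu_t(dx)=\int_{[0,H^s)}\psi(x+t)\tfrac{\bar G^s(x+t)}{\bar G^s(x)}\nu_0(dx)+\int_{[0,t]}\psi(t-s)\bar G^s(t-s)dK(s),$$ where $K(t)=B(t)+D(t)-B(0)=\nu_t[0,H^s)+D(t)-\nu_0[0,H^s)$; $D(t)=\int_0^t\big(\int_{[0,H^s)}h^s(x)\nu_s(dx)\big)ds$; $E(t)+Q(0)=Q(t)+K(t)+R(t)$; $R(t)=\int_0^t\big(\int_{[0,\chi(s)]}h^r(x)\eta_s(dx)\big)ds$;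 $\chi(s)=\inf\{x\in[0,H^r):\eta_s[0,x]\ge Q(s)\}$; $Q(t)=(X(t)-1)^+$; $B(t)=\nu_t[0,\infty)=X(t)\wedge1=1-(1-X(t))^+$; and $Q(t)(1-B(t))=0$. **Whitt's two-parameter fluid model.** Consider functions with Lebesgue integrable densities in the second variable: $B(t,y)=\int_0^y b(t,x)dx\le 1$, $\tilde Q(t,y)=\int_0^y\tilde q(t,x)dx\ge 0$, $Q(t,y)=\int_0^y q(t,x)dx\ge 0$, where $\tilde q(0,\cdot)=q(0,\cdot)$ has support in $[0,H^r)$ and $b(0,\cdot)$ has support in $[0,H^s)$. The pair $(B(t,y),Q(t,y))$ is a two-parameter fluid model tracking elapsed times with input data $(\lambda(\cdot),\tilde q(0,x),b(0,x))$ if: (i) $b(t+u,x+u)=b(t,x)\frac{\bar G^s(x+u)}{\bar G^s(x)}$ for $x\in[0,H^s)$, $t\ge0$, $u>0$. (ii) $\tilde q(t+u,x+u)=\tilde q(t,x)\frac{\bar G^r(x+u)}{\bar G^r(x)}$ for $x\in[0,H^r)$, $t\ge0$, $u>0$. (iii) There is a queue boundary function $w(t)$ such that $\tilde Q(t,w(t))=Q(t,\infty)$, and $q(t,x)=\tilde q(t,x)$ for $x\le w(t)$, $q(t,x)=0$ for $x>w(t)$. (iv) With $\sigma(t)=\int_{[0,H^s)}b(t,x)h^s(x)dx$: $b(t,0)=\lambda(t)$ if $B(t,\infty)<1$; $b(t,0)=\sigma(t)\wedge\lambda(t)$ if $B(t,\infty)=1$ and $Q(t,\infty)=0$; $b(t,0)=\sigma(t)$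 if $B(t,\infty)=1$ and $Q(t,\infty)>0$. Also $\tilde q(t,0)=\lambda(t)$. And $q(t,0)=\lambda(t)$ if $Q(t,\infty)>0$ ($w(t)>0$); $q(t,0)=\lambda(t)-(\sigma(t)\wedge\lambda(t))$ if $B(t,\infty)=1$ and $Q(t,\infty)=0$; $q(t,0)=0$ if $B(t,\infty)<1$. (v) With $\alpha(t)=\int_{[0,H^r)}q(t,x)h^r(x)dx$, for $t\ge 0$: $\int_0^t\lambda(s)ds+\int_0^\infty q(0,x)dx=\int_0^\infty q(t,x)dx+\int_0^t b(s,0)ds+\int_0^t\alpha(s)ds$.
   Formalization: In (iii), q(t,x)=q̃(t,x) is required only for 0<x≤w(t), since at x=0 with w(t)=0 it contradicts (iv); b(t,0)=σ(t) is required only where σ(t) is finite (shown for a.e. t); initial densities are matched almost everywhere. *)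

theory Defs
  imports "HOL-Probability.Probability"
begin

section \<open>Primitives\<close>

(* G(0+) = 0 is automatic for a law with a density that is concentrated on [0,oo). *)
definition lifetime_law :: "(real \<Rightarrow> real) \<Rightarrow> (real \<Rightarrow> real) \<Rightarrow> bool" where
  "lifetime_law G g \<longleftrightarrow>
     g \<in> borel_measurable borel \<and> (\<forall>x. 0 \<le> g x) \<and> (\<forall>x<0. g x = 0) \<and>
     prob_space (density lborel (\<lambda>x. ennreal (g x))) \<and>
     G = cdf (density lborel (\<lambda>x. ennreal (g x)))"

definition arrival_rate :: "(real \<Rightarrow> real) \<Rightarrow> bool" where
  "arrival_rate lam \<longleftrightarrow>
     (\<forall>t\<ge>0. 0 \<le> lam t) \<and> (\<forall>t\<ge>0. set_integrable lborel {0..t} lam)"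

definition arrivals :: "(real \<Rightarrow> real) \<Rightarrow> real \<Rightarrow> real" where
  "arrivals lam t = (LINT s:{0..t}|lborel. lam s)"

definition surv :: "(real \<Rightarrow> real) \<Rightarrow> real \<Rightarrow> real" where
  "surv G x = 1 - G x"

(* Extended-real valued: the value is infinity if G never reaches 1. *)
definition right_end :: "(real \<Rightarrow> real) \<Rightarrow> ereal" where
  "right_end G = (INF x\<in>{x. 0 \<le> x \<and> G x = 1}. ereal x)"

definition ages :: "(real \<Rightarrow> real) \<Rightarrow> real set" where
  "ages G = {x. 0 \<le> x \<and> ereal x < right_end G}"

definition hazard :: "(real \<Rightarrow> real) \<Rightarrow> (real \<Rightarrow> real) \<Rightarrow> real \<Rightarrow> real" where
  "hazard G g x = g x / surv G x"

(* "Support in [0,H)" means that the measure is carried by [0,H): the closed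
   topological support may contain H. *)
definition age_measure :: "(real \<Rightarrow> real) \<Rightarrow> real measure \<Rightarrow> bool" where
  "age_measure G \<mu> \<longleftrightarrow>
     sets \<mu> = sets borel \<and> finite_measure \<mu> \<and> emeasure \<mu> (- ages G) = 0"

definition has_age_density :: "real measure \<Rightarrow> (real \<Rightarrow> real) \<Rightarrow> bool" where
  "has_age_density \<mu> f \<longleftrightarrow>
     f \<in> borel_measurable borel \<and> (\<forall>x\<ge>0. 0 \<le> f x) \<and>
     \<mu> = density lborel (\<lambda>x. ennreal (f x) * indicator {0..} x)"

definition initial_states ::
  "(real \<Rightarrow> real) \<Rightarrow> (real \<Rightarrow> real) \<Rightarrow> (real measure \<times> real measure \<times> real) set" where
  "initial_states Gr Gs =
     {(\<eta>, \<nu>, x). age_measure Gr \<eta> \<and> age_measure Gs \<nu> \<and> 0 \<le> x \<and>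
        1 - measure \<nu> (ages Gs) = max (1 - x) 0 \<and>
        measure \<nu> (ages Gs) + measure \<eta> (ages Gr) = x}"


section \<open>The measure-valued fluid model\<close>

definition queue :: "(real \<Rightarrow> real) \<Rightarrow> real \<Rightarrow> real" where
  "queue X t = max (X t - 1) 0"

definition busy :: "(real \<Rightarrow> real measure) \<Rightarrow> real \<Rightarrow> real" where
  "busy \<nu> t = measure (\<nu> t) {0..}"

(* The infimum is infinity when no finite age attains the level Q(t).  This does occur,
   for instance at t = 0 when eta_0 has unbounded support: then Q(0) is all its mass. *)
definition head_age ::
  "(real \<Rightarrow> real) \<Rightarrow> (real \<Rightarrow> real measure) \<Rightarrow> (real \<Rightarrow> real) \<Rightarrow> real \<Rightarrow> ereal" where
  "head_age Gr \<eta> X t = (INF x\<in>{x \<in> ages Gr. queue X t \<le> measure (\<eta> t) {0..x}}. ereal x)"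

definition departure_rate ::
  "(real \<Rightarrow> real) \<Rightarrow> (real \<Rightarrow> real) \<Rightarrow> (real \<Rightarrow> real measure) \<Rightarrow> real \<Rightarrow> ennreal" where
  "departure_rate Gs gs \<nu> s = (\<integral>\<^sup>+x\<in>ages Gs. ennreal (hazard Gs gs x) \<partial>\<nu> s)"

definition reneging_rate ::
  "(real \<Rightarrow> real) \<Rightarrow> (real \<Rightarrow> real) \<Rightarrow> (real \<Rightarrow> real measure) \<Rightarrow> (real \<Rightarrow> real) \<Rightarrow>
   real \<Rightarrow> ennreal" where
  "reneging_rate Gr gr \<eta> X s =
     (\<integral>\<^sup>+x\<in>{x \<in> ages Gr. ereal x \<le> head_age Gr \<eta> X s}. ennreal (hazard Gr gr x) \<partial>\<eta> s)"

(* A rate r whose integrals over bounded time intervals are well defined and finite. *)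
definition locally_integrable_rate :: "(real \<Rightarrow> ennreal) \<Rightarrow> bool" where
  "locally_integrable_rate r \<longleftrightarrow>
     r \<in> borel_measurable (restrict_space borel {0..}) \<and>
     (\<forall>t\<ge>0. (\<integral>\<^sup>+s\<in>{0..t}. r s \<partial>lborel) < \<infinity>)"

definition cumulative :: "(real \<Rightarrow> ennreal) \<Rightarrow> real \<Rightarrow> real" where
  "cumulative r t = enn2real (\<integral>\<^sup>+s\<in>{0..t}. r s \<partial>lborel)"

definition service_entries ::
  "(real \<Rightarrow> real) \<Rightarrow> (real \<Rightarrow> real) \<Rightarrow> (real \<Rightarrow> real measure) \<Rightarrow> real \<Rightarrow> real" where
  "service_entries Gs gs \<nu> t =
     busy \<nu> t + cumulative (departure_rate Gs gs \<nu>) t - busy \<nu> 0"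

(* dK is the Stieltjes measure of K, with K extended by K(0) = 0 to negative times.
   No regularity of K needs to be imposed: adding the equations for K and Q gives
   X = X(0) + E - D - R, so X is continuous and locally absolutely continuous.  Then so are
   B = min X 1 and K, and the same equations force K to be nondecreasing, because R does
   not grow while Q = 0 (for t > 0, eta_t has no atom at 0). *)
definition measure_valued_fluid_model ::
  "(real \<Rightarrow> real) \<Rightarrow> (real \<Rightarrow> real) \<Rightarrow> (real \<Rightarrow> real) \<Rightarrow> (real \<Rightarrow> real) \<Rightarrow> (real \<Rightarrow> real) \<Rightarrow>
   (real \<Rightarrow> real measure) \<Rightarrow> (real \<Rightarrow> real measure) \<Rightarrow> (real \<Rightarrow> real) \<Rightarrow> bool" where
  "measure_valued_fluid_model Gs gs Gr gr lam \<eta> \<nu> X \<longleftrightarrow>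
     (\<forall>t\<ge>0. age_measure Gr (\<eta> t) \<and> age_measure Gs (\<nu> t)) \<and>
     locally_integrable_rate (departure_rate Gs gs \<nu>) \<and>
     locally_integrable_rate (reneging_rate Gr gr \<eta> X) \<and>
     (\<forall>\<psi> t. continuous_on {0..} \<psi> \<and> bounded (\<psi> ` {0..}) \<and> 0 \<le> t \<longrightarrow>
        (LINT x:{0..}|\<eta> t. \<psi> x) =
          (LINT x:ages Gr|\<eta> 0. \<psi> (x + t) * (surv Gr (x + t) / surv Gr x)) +
          (LINT s:{0..t}|lborel. \<psi> (t - s) * surv Gr (t - s) * lam s)) \<and>
     (\<forall>\<psi> t. continuous_on {0..} \<psi> \<and> bounded (\<psi> ` {0..}) \<and> 0 \<le> t \<longrightarrow>
        (LINT x:{0..}|\<nu> t. \<psi> x) =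
          (LINT x:ages Gs|\<nu> 0. \<psi> (x + t) * (surv Gs (x + t) / surv Gs x)) +
          (LINT s:{0..t}|interval_measure (\<lambda>s. service_entries Gs gs \<nu> (max 0 s)).
             \<psi> (t - s) * surv Gs (t - s))) \<and>
     (\<forall>t\<ge>0. arrivals lam t + queue X 0 =
        queue X t + service_entries Gs gs \<nu> t + cumulative (reneging_rate Gr gr \<eta> X) t) \<and>
     (\<forall>t\<ge>0. busy \<nu> t = min (X t) 1 \<and> busy \<nu> t = 1 - max (1 - X t) 0) \<and>
     (\<forall>t\<ge>0. queue X t * (1 - busy \<nu> t) = 0)"


section \<open>The two-parameter fluid model\<close>

definition mass :: "(real \<Rightarrow> real) \<Rightarrow> real" where
  "mass f = (LINT x:{0..}|lborel. f x)"

definition age_density_family :: "(real \<Rightarrow> real \<Rightarrow> real) \<Rightarrow> bool" where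
  "age_density_family f \<longleftrightarrow>
     (\<forall>t\<ge>0. set_integrable lborel {0..} (f t) \<and> (\<forall>x\<ge>0. 0 \<le> f t x))"

definition hazard_flow ::
  "(real \<Rightarrow> real) \<Rightarrow> (real \<Rightarrow> real) \<Rightarrow> (real \<Rightarrow> real \<Rightarrow> real) \<Rightarrow> real \<Rightarrow> ennreal" where
  "hazard_flow G g f t = (\<integral>\<^sup>+x\<in>ages G. ennreal (f t x * hazard G g x) \<partial>lborel)"

definition aging :: "(real \<Rightarrow> real) \<Rightarrow> (real \<Rightarrow> real \<Rightarrow> real) \<Rightarrow> bool" where
  "aging G f \<longleftrightarrow>
     (\<forall>t u x. 0 \<le> t \<and> 0 < u \<and> x \<in> ages G \<longrightarrow>
        f (t + u) (x + u) = f t x * (surv G (x + u) / surv G x))"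

(* Initial densities are prescribed up to null sets, as densities are: the values at age 0
   are dictated by the boundary conditions, also at time 0. *)
definition initial_densities ::
  "(real \<Rightarrow> real) \<Rightarrow> (real \<Rightarrow> real) \<Rightarrow> (real \<Rightarrow> real) \<Rightarrow> (real \<Rightarrow> real) \<Rightarrow>
   (real \<Rightarrow> real \<Rightarrow> real) \<Rightarrow> (real \<Rightarrow> real \<Rightarrow> real) \<Rightarrow> (real \<Rightarrow> real \<Rightarrow> real) \<Rightarrow> bool" where
  "initial_densities Gs Gr qt0 b0 b qt q \<longleftrightarrow>
     (AE x in lborel. 0 \<le> x \<longrightarrow> b 0 x = b0 x \<and> qt 0 x = qt0 x \<and> q 0 x = qt 0 x) \<and>
     (\<forall>x\<ge>0. x \<notin> ages Gs \<longrightarrow> b 0 x = 0) \<and>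
     (\<forall>x\<ge>0. x \<notin> ages Gr \<longrightarrow> qt 0 x = 0 \<and> q 0 x = 0)"

(* The boundary w may be infinite (see head_age).  Age x = 0 is left to the boundary
   conditions: when the queue is empty, w(t) = 0, and the prescribed values
   qt(t,0) = lam(t) and q(t,0) generally differ. *)
definition queue_boundary ::
  "(real \<Rightarrow> real \<Rightarrow> real) \<Rightarrow> (real \<Rightarrow> real \<Rightarrow> real) \<Rightarrow> (real \<Rightarrow> ereal) \<Rightarrow> bool" where
  "queue_boundary qt q w \<longleftrightarrow>
     (\<forall>t\<ge>0. 0 \<le> w t \<and> (0 < w t \<longleftrightarrow> 0 < mass (q t)) \<and>
        (LINT x:{x. 0 \<le> x \<and> ereal x \<le> w t}|lborel. qt t x) = mass (q t) \<and>
        (\<forall>x>0. (ereal x \<le> w t \<longrightarrow> q t x = qt t x) \<and> (w t < ereal x \<longrightarrow> q t x = 0)))"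

(* The service completion rate sigma is extended-real valued.  It is finite at almost all
   times; where it is infinite, b(t,0) = sigma(t) is not imposed, while min(sigma, lam)
   is finite anyway. *)
definition boundary_conditions ::
  "(real \<Rightarrow> real) \<Rightarrow> (real \<Rightarrow> ennreal) \<Rightarrow>
   (real \<Rightarrow> real \<Rightarrow> real) \<Rightarrow> (real \<Rightarrow> real \<Rightarrow> real) \<Rightarrow> (real \<Rightarrow> real \<Rightarrow> real) \<Rightarrow> bool" where
  "boundary_conditions lam \<sigma> b qt q \<longleftrightarrow>
     (AE t in lborel. 0 \<le> t \<longrightarrow> \<sigma> t < \<infinity>) \<and>
     (\<forall>t\<ge>0.
        (mass (b t) < 1 \<longrightarrow> b t 0 = lam t) \<and>
        (mass (b t) = 1 \<and> mass (q t) = 0 \<longrightarrow>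
           b t 0 = enn2real (min (\<sigma> t) (ennreal (lam t)))) \<and>
        (mass (b t) = 1 \<and> 0 < mass (q t) \<and> \<sigma> t < \<infinity> \<longrightarrow> b t 0 = enn2real (\<sigma> t)) \<and>
        qt t 0 = lam t \<and>
        (0 < mass (q t) \<longrightarrow> q t 0 = lam t) \<and>
        (mass (b t) = 1 \<and> mass (q t) = 0 \<longrightarrow>
           q t 0 = lam t - enn2real (min (\<sigma> t) (ennreal (lam t)))) \<and>
        (mass (b t) < 1 \<longrightarrow> q t 0 = 0))"

definition flow_balance ::
  "(real \<Rightarrow> real) \<Rightarrow> (real \<Rightarrow> ennreal) \<Rightarrow>
   (real \<Rightarrow> real \<Rightarrow> real) \<Rightarrow> (real \<Rightarrow> real \<Rightarrow> real) \<Rightarrow> bool" where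
  "flow_balance lam \<alpha> b q \<longleftrightarrow>
     locally_integrable_rate \<alpha> \<and>
     (\<forall>t\<ge>0. set_integrable lborel {0..t} (\<lambda>s. b s 0) \<and>
        arrivals lam t + mass (q 0) =
          mass (q t) + (LINT s:{0..t}|lborel. b s 0) + cumulative \<alpha> t)"

(* The pair (B,Q) comes with the auxiliary function Qt.  The defining conditions are about
   densities b, qt, q of B, Qt, Q in the age variable, which B, Qt, Q determine only up to
   null sets; the model requires versions satisfying the conditions. *)
definition two_parameter_fluid_model ::
  "(real \<Rightarrow> real) \<Rightarrow> (real \<Rightarrow> real) \<Rightarrow> (real \<Rightarrow> real) \<Rightarrow> (real \<Rightarrow> real) \<Rightarrow> (real \<Rightarrow> real) \<Rightarrow>
   (real \<Rightarrow> real) \<Rightarrow> (real \<Rightarrow> real) \<Rightarrow>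
   (real \<Rightarrow> real \<Rightarrow> real) \<Rightarrow> (real \<Rightarrow> real \<Rightarrow> real) \<Rightarrow> (real \<Rightarrow> real \<Rightarrow> real) \<Rightarrow> bool" where
  "two_parameter_fluid_model Gs gs Gr gr lam qt0 b0 B Qt Q \<longleftrightarrow>
     (\<exists>b qt q.
        age_density_family b \<and> age_density_family qt \<and> age_density_family q \<and>
        (\<forall>t\<ge>0. \<forall>y\<ge>0.
           B t y = (LINT x:{0..y}|lborel. b t x) \<and> B t y \<le> 1 \<and>
           Qt t y = (LINT x:{0..y}|lborel. qt t x) \<and> 0 \<le> Qt t y \<and>
           Q t y = (LINT x:{0..y}|lborel. q t x) \<and> 0 \<le> Q t y) \<and>
        initial_densities Gs Gr qt0 b0 b qt q \<and>
        aging Gs b \<and> aging Gr qt \<and>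
        (\<exists>w. queue_boundary qt q w) \<and>
        boundary_conditions lam (hazard_flow Gs gs b) b qt q \<and>
        flow_balance lam (hazard_flow Gr gr q) b q)"

end

theory Submission
  imports Defs
begin

text \<open>
  The measure-valued model transports the initial density and the inflow along ages and thins both
  by survival, so \<open>\<eta>\<^sub>t\<close> has the density \<open>qt t x = lam (t - x) * surv Gr x\<close> for
  \<open>x \<le> t\<close> and \<open>qt0 (x - t) * surv Gr x / surv Gr (x - t)\<close> for \<open>x > t\<close>, and \<open>\<nu>\<^sub>t\<close> has a density of the same form
  as soon as \<open>K\<close> is absolutely continuous. Adding the balance equations gives
  \<open>X' = lam - \<sigma> - \<rho>\<close> almost everywhere, and \<open>\<rho> = 0\<close> while the queue is empty. Since \<open>B = min X 1\<close>,
  \<open>K' = B' + \<sigma>\<close> equals \<open>lam\<close> where \<open>X < 1\<close> and \<open>\<sigma>\<close> where \<open>X > 1\<close>; on the level set \<open>X = 1\<close> the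
  derivative of \<open>X\<close> vanishes almost everywhere, so \<open>\<sigma> = lam\<close> there. This is the prescribed boundary
  value of \<open>b\<close>. The queue is \<open>\<eta>\<^sub>t\<close> cut at the head age, which requires \<open>Q t\<close> to be at most
  the mass of \<open>\<eta>\<^sub>t\<close>: this holds at time 0, and whenever it fails the difference does not increase.
\<close>

section \<open>Locally absolutely continuous functions\<close>

text \<open>Derivatives never appear pointwise: \<open>indefinite_integral F f\<close> says that
  \<open>F\<close> is a primitive of \<open>f\<close> on \<open>[0,\<infinity>)\<close>, with
  \<open>f\<close> fixed only up to null sets, and every claim about \<open>X'\<close>, positive
  parts or level sets is a claim about such pairs. Kinks are reached from smooth functions by
  dominated convergence. The obstacle that shapes the proof is circularity: the equation for
  \<open>\<nu>\<close> integrates against \<open>dK\<close>, while \<open>K\<close> is built from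
  \<open>\<nu>\<close> and comes with no regularity or monotonicity. The order of dependence
  resolves it. The equation for \<open>\<eta>\<close> involves only arrivals and patience, so its
  density is available at once; age 0 is then a null set and reneging stops when the queue is empty.
  Local integrability of the two rates makes \<open>X\<close>, the queue and \<open>K\<close>
  primitives, and the derivative \<open>\<beta>\<close> found for \<open>K\<close> is nonnegative.
  Only then is \<open>dK\<close> a measure with a density, so that \<open>\<nu>\<^sub>t\<close> can
  be identified.\<close>

definition indefinite_integral :: "(real \<Rightarrow> real) \<Rightarrow> (real \<Rightarrow> real) \<Rightarrow> bool" where
  "indefinite_integral F f \<longleftrightarrow>
     (\<forall>t\<ge>0. set_integrable lborel {0..t} f \<and> F t = F 0 + (LINT s:{0..t}|lborel. f s))"

lemma set_integrable_mult_bounded: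
  fixes f g :: "'a \<Rightarrow> real"
  assumes f: "set_integrable M A f"
    and g: "(\<lambda>x. indicator A x * g x) \<in> borel_measurable M"
    and le: "\<And>x. x \<in> A \<Longrightarrow> \<bar>g x\<bar> \<le> C"
  shows "set_integrable M A (\<lambda>x. g x * f x)"
proof -
  have fi: "integrable M (\<lambda>x. indicator A x * f x)"
    using f by (simp add: set_integrable_def)
  have "integrable M (\<lambda>x. (indicator A x * g x) * (indicator A x * f x))"
  proof (rule Bochner_Integration.integrable_bound[where f = "\<lambda>x. C * (indicator A x * f x)"])
    show "AE x in M. norm ((indicator A x * g x) * (indicator A x * f x))
      \<le> norm (C * (indicator A x * f x))"
    proof (rule AE_I2)
      fix x
      have "x \<in> A \<Longrightarrow> \<bar>g x\<bar> * \<bar>f x\<bar> \<le> \<bar>C\<bar> * \<bar>f x\<bar>"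
        using le[of x] by (intro mult_right_mono) auto
      then show "norm ((indicator A x * g x) * (indicator A x * f x))
          \<le> norm (C * (indicator A x * f x))"
        by (auto simp: indicator_def abs_mult)
    qed
  qed (use fi g in auto)
  moreover have "(\<lambda>x. (indicator A x * g x) * (indicator A x * f x))
      = (\<lambda>x. indicator A x * (g x * f x))"
    by (auto simp: indicator_def)
  ultimately show ?thesis by (simp add: set_integrable_def)
qed

lemma set_integral_Icc_split:
  fixes f :: "real \<Rightarrow> real"
  assumes "0 \<le> a" "a \<le> b" "set_integrable lborel {0..b} f"
  shows "(LINT s:{0..b}|lborel. f s) = (LINT s:{0..a}|lborel. f s) + (LINT s:{a<..b}|lborel. f s)"
proof -
  have "{0..b} = {0..a} \<union> {a<..b}" using assms by auto
  then show ?thesis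
    using assms by (auto intro!: set_integral_Un set_integrable_subset[OF assms(3)])
qed

lemma indefinite_integral_integrable:
  "indefinite_integral F f \<Longrightarrow> set_integrable lborel {0..t} f"
  by (cases "0 \<le> t") (auto simp: indefinite_integral_def)

lemma indefinite_integralD:
  "indefinite_integral F f \<Longrightarrow> 0 \<le> t \<Longrightarrow> F t = F 0 + (LINT s:{0..t}|lborel. f s)"
  unfolding indefinite_integral_def by blast

lemma indefinite_integral_increment:
  assumes "indefinite_integral F f" "0 \<le> a" "a \<le> b"
  shows "F b - F a = (LINT s:{a<..b}|lborel. f s)"
proof -
  have "F b = F 0 + (LINT s:{0..b}|lborel. f s)" "F a = F 0 + (LINT s:{0..a}|lborel. f s)"
    using assms by (intro indefinite_integralD[OF assms(1)]; linarith)+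
  then show ?thesis
    using set_integral_Icc_split[OF assms(2,3) indefinite_integral_integrable[OF assms(1)]] by simp
qed

text \<open>On compact intervals this is continuity of the gauge integral in its upper limit. It
  extends to the half-line because \<open>{0..<x+1}\<close> is a neighbourhood of \<open>x\<close>
  within \<open>{0..}\<close>.\<close>

lemma indefinite_integral_continuous:
  assumes "indefinite_integral F f"
  shows "continuous_on {0..} F"
proof -
  have "continuous_on {0..<T} F" for T
  proof -
    have "f integrable_on {0..T}"
      using set_borel_integral_eq_integral(1)[OF indefinite_integral_integrable[OF assms]] by simp
    then have "continuous_on {0..T} (\<lambda>t. F 0 + integral {0..t} f)"
      by (intro continuous_intros indefinite_integral_continuous_1)
    moreover have "F 0 + integral {0..t} f = F t" if "t \<in> {0..T}" for t
    proof -
      have "F t = F 0 + (LINT s:{0..t}|lborel. f s)"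
        using that by (intro indefinite_integralD[OF assms]) auto
      then show ?thesis
        by (simp only: set_borel_integral_eq_integral(2)[OF indefinite_integral_integrable[OF assms]])
    qed
    ultimately have "continuous_on {0..T} F"
      by (rule continuous_on_eq) auto
    then show ?thesis by (rule continuous_on_subset) auto
  qed
  then have "continuous (at x within {0..}) F" if "x \<ge> 0" for x
  proof -
    have "continuous (at x within {0..<x+1}) F"
      using \<open>continuous_on {0..<x+1} F\<close> that by (auto simp: continuous_on_eq_continuous_within)
    moreover have "at x within {0..<x+1} = at x within {0..}"
      by (rule at_within_nhd[where S="{..<x+1}"]) auto
    ultimately show ?thesis by simp
  qed
  then show ?thesis by (auto simp: continuous_on_eq_continuous_within)
qed

lemma indefinite_integral_shift:
  assumes "indefinite_integral F f" "\<And>t. 0 \<le> t \<Longrightarrow> G t - G 0 = F t - F 0"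
  shows "indefinite_integral G f"
  using assms unfolding indefinite_integral_def by (metis add_diff_cancel_left' diff_add_cancel add.commute)

lemma indefinite_integral_add:
  assumes "indefinite_integral F f" "indefinite_integral G g"
  shows "indefinite_integral (\<lambda>t. F t + G t) (\<lambda>s. f s + g s)"
  unfolding indefinite_integral_def
proof (intro allI impI conjI)
  fix t :: real assume t: "0 \<le> t"
  note i = indefinite_integral_integrable[OF assms(1), of t] indefinite_integral_integrable[OF assms(2), of t]
  show "set_integrable lborel {0..t} (\<lambda>s. f s + g s)" by (rule set_integral_add(1)[OF i])
  show "F t + G t = F 0 + G 0 + (LINT s:{0..t}|lborel. f s + g s)"
    using set_integral_add(2)[OF i] indefinite_integralD[OF assms(1) t] indefinite_integralD[OF assms(2) t]
    by linarith
qed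

lemma indefinite_integral_diff:
  assumes "indefinite_integral F f" "indefinite_integral G g"
  shows "indefinite_integral (\<lambda>t. F t - G t) (\<lambda>s. f s - g s)"
  unfolding indefinite_integral_def
proof (intro allI impI conjI)
  fix t :: real assume t: "0 \<le> t"
  note i = indefinite_integral_integrable[OF assms(1), of t] indefinite_integral_integrable[OF assms(2), of t]
  show "set_integrable lborel {0..t} (\<lambda>s. f s - g s)" by (rule set_integral_diff(1)[OF i])
  show "F t - G t = F 0 - G 0 + (LINT s:{0..t}|lborel. f s - g s)"
    using set_integral_diff(2)[OF i] indefinite_integralD[OF assms(1) t] indefinite_integralD[OF assms(2) t]
    by linarith
qed

lemma indefinite_integral_cmult:
  assumes "indefinite_integral F f"
  shows "indefinite_integral (\<lambda>t. c * F t) (\<lambda>s. c * f s)"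
  unfolding indefinite_integral_def
proof (intro allI impI conjI)
  fix t :: real assume t: "0 \<le> t"
  show "set_integrable lborel {0..t} (\<lambda>s. c * f s)"
    using indefinite_integral_integrable[OF assms] by simp
  show "c * F t = c * F 0 + (LINT s:{0..t}|lborel. c * f s)"
    by (subst indefinite_integralD[OF assms t]) (simp only: set_integral_mult_right distrib_left)
qed

section \<open>Chain rule, level sets and positive parts\<close>

lemma continuous_on_set_measurable:
  fixes g :: "real \<Rightarrow> real"
  assumes "continuous_on {0..} g"
  shows "(\<lambda>x. indicator {0..t} x * g x) \<in> borel_measurable lborel"
proof -
  have "continuous_on {0..t} g" by (rule continuous_on_subset[OF assms]) auto
  then have "(\<lambda>x. indicator {0..t} x *\<^sub>R g x) \<in> borel_measurable borel"
    by (intro borel_measurable_continuous_on_indicator) auto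
  then show ?thesis by simp
qed

text \<open>On a short interval the mean value theorem replaces the increment of
  \<open>\<phi> \<circ> F\<close> by \<open>\<phi>' \<xi>\<close> times the integral of
  \<open>f\<close>, and continuity of \<open>\<phi>'\<close> bounds the error by \<open>e\<close>
  times the integral of \<open>\<bar>f\<bar>\<close>. This bound is additive over adjacent
  intervals, so bisection carries it to \<open>[0,t]\<close>, and \<open>e\<close> is
  arbitrary.\<close>

lemma indefinite_integral_chain_rule:
  assumes F: "indefinite_integral F f"
    and \<phi>: "\<And>x. (\<phi> has_real_derivative \<phi>' x) (at x)"
    and cont_\<phi>': "continuous_on UNIV \<phi>'"
  shows "indefinite_integral (\<lambda>t. \<phi> (F t)) (\<lambda>s. \<phi>' (F s) * f s)"
proof -
  note fi = indefinite_integral_integrable[OF F]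
  have cF: "continuous_on {0..} F" by (rule indefinite_integral_continuous[OF F])
  have c\<phi>F: "continuous_on {0..} (\<lambda>s. \<phi>' (F s))"
    by (rule continuous_on_compose2[OF cont_\<phi>' cF]) auto
  have int: "set_integrable lborel {0..t} (\<lambda>s. \<phi>' (F s) * f s)" for t
  proof -
    have "compact ((\<lambda>s. \<phi>' (F s)) ` {0..t})"
      by (intro compact_continuous_image continuous_on_subset[OF c\<phi>F]) auto
    then obtain C where "\<forall>x\<in>{0..t}. \<bar>\<phi>' (F x)\<bar> \<le> C"
      by (auto dest!: compact_imp_bounded simp: bounded_iff)
    then have "\<And>x. x \<in> {0..t} \<Longrightarrow> \<bar>\<phi>' (F x)\<bar> \<le> C" by blast
    then show ?thesis
      by (intro set_integrable_mult_bounded[where C=C] fi continuous_on_set_measurable c\<phi>F)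
  qed
  have sub: "set_integrable lborel {a<..b} g"
    if "set_integrable lborel {0..b} g" "0 \<le> a" for a b and g :: "real \<Rightarrow> real"
    by (rule set_integrable_subset[OF that(1)]) (use that in auto)
  have approx: "\<bar>\<phi> (F t) - \<phi> (F 0) - (LINT s:{0<..t}|lborel. \<phi>' (F s) * f s)\<bar>
      \<le> e * (LINT s:{0<..t}|lborel. \<bar>f s\<bar>)" if t: "0 \<le> t" and e: "e > 0" for t e :: real
  proof -
    \<comment> \<open>Both sides of the estimate add up over adjacent intervals, as the transitivity
      case of \<open>Bolzano\<close> requires. The guards keep the intervals inside
      \<open>[0,t]\<close>.\<close>
    define P where "P a b \<longleftrightarrow> (0 \<le> a \<longrightarrow> b \<le> t \<longrightarrow>
      \<bar>\<phi> (F b) - \<phi> (F a) - (LINT s:{a<..b}|lborel. \<phi>' (F s) * f s)\<bar>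
      \<le> e * (LINT s:{a<..b}|lborel. \<bar>f s\<bar>))" for a b
    have "P 0 t" using t
    proof (induction rule: Bolzano)
      case (trans a b c)
      have "(LINT s:{a<..c}|lborel. h s) = (LINT s:{a<..b}|lborel. h s) + (LINT s:{b<..c}|lborel. h s)"
        if "set_integrable lborel {0..c} h" "0 \<le> a" for h :: "real \<Rightarrow> real"
      proof -
        have "{a<..c} = {a<..b} \<union> {b<..c}" using trans by auto
        moreover have "set_integrable lborel {a<..b} h" "set_integrable lborel {b<..c} h"
          using trans that by (auto intro!: set_integrable_subset[OF that(1)])
        ultimately show ?thesis by (auto intro!: set_integral_Un)
      qed
      from this[OF int] this[OF set_integrable_abs[OF fi]] trans show ?case
        unfolding P_def by (auto simp: algebra_simps)
    next
      case (local x)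
      have "isCont \<phi>' (F x)" using cont_\<phi>' by (simp add: continuous_on_eq_continuous_at)
      then obtain r where r: "r > 0" "\<And>y. \<bar>y - F x\<bar> < r \<Longrightarrow> \<bar>\<phi>' y - \<phi>' (F x)\<bar> < e / 2"
        using e unfolding continuous_at_eps_delta dist_real_def by (meson half_gt_zero)
      obtain d where d: "d > 0" "\<And>s. 0 \<le> s \<Longrightarrow> \<bar>s - x\<bar> < d \<Longrightarrow> \<bar>F s - F x\<bar> < r"
        using cF local r unfolding continuous_on_iff dist_real_def by (metis atLeast_iff)
      have "P a b" if ab: "a \<le> x \<and> x \<le> b \<and> b - a < d" for a b
        unfolding P_def
      proof (intro impI)
        assume a: "0 \<le> a" and b: "b \<le> t"
        have Fs: "\<bar>F s - F x\<bar> < r" if "s \<in> {a..b}" for s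
          using that ab a by (intro d) auto
        \<comment> \<open>The intermediate point lies between \<open>F a\<close> and
          \<open>F b\<close>, hence also within \<open>r\<close> of \<open>F x\<close>. The mean
          value theorem needs distinct endpoints; if they coincide, any point near
          \<open>F x\<close> serves.\<close>
        have "\<exists>\<xi>. \<bar>\<xi> - F x\<bar> < r \<and> \<phi> (F b) - \<phi> (F a) = \<phi>' \<xi> * (F b - F a)"
        proof (cases "F a = F b")
          case True
          then show ?thesis using r(1) by (intro exI[of _ "F x"]) auto
        next
          case False
          then consider "F a < F b" | "F b < F a" by linarith
          then show ?thesis
          proof cases
            case 1
            from MVT2[OF this \<phi>] obtain z where "F a < z" "z < F b"
              "\<phi> (F b) - \<phi> (F a) = (F b - F a) * \<phi>' z" by auto
            with Fs[of a] Fs[of b] ab show ?thesis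
              by (intro exI[of _ z]) (auto simp: algebra_simps)
          next
            case 2
            from MVT2[OF this \<phi>] obtain z where "F b < z" "z < F a"
              "\<phi> (F a) - \<phi> (F b) = (F a - F b) * \<phi>' z" by auto
            with Fs[of a] Fs[of b] ab show ?thesis
              by (intro exI[of _ z]) (auto simp: algebra_simps)
          qed
        qed
        then obtain \<xi> where \<xi>: "\<bar>\<xi> - F x\<bar> < r" "\<phi> (F b) - \<phi> (F a) = \<phi>' \<xi> * (F b - F a)" by auto
        have inc: "F b - F a = (LINT s:{a<..b}|lborel. f s)"
          using indefinite_integral_increment[OF F a] ab by auto
        have i1: "set_integrable lborel {a<..b} (\<lambda>s. \<phi>' \<xi> * f s)"
          using sub[OF fi a] by simp
        note i2 = sub[OF int a]
        have "\<phi> (F b) - \<phi> (F a) - (LINT s:{a<..b}|lborel. \<phi>' (F s) * f s)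
            = (LINT s:{a<..b}|lborel. \<phi>' \<xi> * f s - \<phi>' (F s) * f s)"
          using set_integral_diff(2)[OF i1 i2] \<xi>(2) inc by simp
        also have "\<bar>\<dots>\<bar> \<le> (LINT s:{a<..b}|lborel. \<bar>\<phi>' \<xi> * f s - \<phi>' (F s) * f s\<bar>)"
          using set_integral_norm_bound[OF set_integral_diff(1)[OF i1 i2]] by simp
        also have "\<dots> \<le> (LINT s:{a<..b}|lborel. e * \<bar>f s\<bar>)"
        proof (rule set_integral_mono)
          show "set_integrable lborel {a<..b} (\<lambda>s. \<bar>\<phi>' \<xi> * f s - \<phi>' (F s) * f s\<bar>)"
            by (intro set_integrable_abs set_integral_diff(1) i1 i2)
          show "set_integrable lborel {a<..b} (\<lambda>s. e * \<bar>f s\<bar>)"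
            by (intro set_integrable_mult_right set_integrable_abs sub[OF fi a])
          fix s assume s: "s \<in> {a<..b}"
          then have "\<bar>\<phi>' (F s) - \<phi>' (F x)\<bar> < e/2" by (intro r Fs) auto
          moreover have "\<bar>\<phi>' \<xi> - \<phi>' (F x)\<bar> < e/2" by (intro r \<xi>)
          ultimately have "\<bar>\<phi>' \<xi> - \<phi>' (F s)\<bar> \<le> e" by linarith
          then have "\<bar>\<phi>' \<xi> - \<phi>' (F s)\<bar> * \<bar>f s\<bar> \<le> e * \<bar>f s\<bar>" by (intro mult_right_mono) auto
          then show "\<bar>\<phi>' \<xi> * f s - \<phi>' (F s) * f s\<bar> \<le> e * \<bar>f s\<bar>"
            by (simp add: abs_mult[symmetric] algebra_simps)
        qed
        finally show "\<bar>\<phi> (F b) - \<phi> (F a) - (LINT s:{a<..b}|lborel. \<phi>' (F s) * f s)\<bar>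
            \<le> e * (LINT s:{a<..b}|lborel. \<bar>f s\<bar>)" by simp
      qed
      then show ?case using d(1) by blast
    qed
    then show ?thesis by (simp add: P_def t)
  qed
  have eq: "\<phi> (F t) = \<phi> (F 0) + (LINT s:{0..t}|lborel. \<phi>' (F s) * f s)" if t: "0 \<le> t" for t
  proof -
    define J where "J = (LINT s:{0<..t}|lborel. \<bar>f s\<bar>)"
    have J: "0 \<le> J" unfolding J_def set_lebesgue_integral_def by (rule integral_nonneg_AE) auto
    have "\<bar>\<phi> (F t) - \<phi> (F 0) - (LINT s:{0<..t}|lborel. \<phi>' (F s) * f s)\<bar> \<le> 0 + e" if "e > 0" for e
    proof -
      \<comment> \<open>The shift by 1 avoids a division by zero when \<open>f\<close> vanishes
        almost everywhere on the interval.\<close>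
      have "e / (J + 1) * J \<le> e" using J that by (simp add: field_simps)
      then show ?thesis using approx[OF t, of "e / (J + 1)"] J that unfolding J_def[symmetric]
        by fastforce
    qed
    then have "\<bar>\<phi> (F t) - \<phi> (F 0) - (LINT s:{0<..t}|lborel. \<phi>' (F s) * f s)\<bar> \<le> 0"
      by (rule field_le_epsilon)
    moreover have "(LINT s:{0..t}|lborel. \<phi>' (F s) * f s) = (LINT s:{0<..t}|lborel. \<phi>' (F s) * f s)"
      by (rule set_integral_discrete_difference[of "{0}"]) auto
    ultimately show ?thesis by simp
  qed
  show ?thesis unfolding indefinite_integral_def using int eq by blast
qed


text \<open>Dominated convergence with bound \<open>C * \<bar>f\<bar>\<close>. The limit
  \<open>\<psi>\<close> may be discontinuous and need not be a derivative of \<open>\<phi>\<close>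
  everywhere, which is what admits \<open>sgn\<close> and the indicator of a point.\<close>

lemma indefinite_integral_chain_rule_limit:
  assumes F: "indefinite_integral F f"
    and \<phi>n: "\<And>n x. (\<phi>n n has_real_derivative \<psi>n n x) (at x)"
    and cont: "\<And>n. continuous_on UNIV (\<psi>n n)"
    and bound: "\<And>n x. \<bar>\<psi>n n x\<bar> \<le> C"
    and \<phi>: "\<And>x. (\<lambda>n. \<phi>n n x) \<longlonglongrightarrow> \<phi> x"
    and \<psi>: "\<And>x. (\<lambda>n. \<psi>n n x) \<longlonglongrightarrow> \<psi> x"
  shows "indefinite_integral (\<lambda>t. \<phi> (F t)) (\<lambda>s. \<psi> (F s) * f s)"
proof -
  have ch: "indefinite_integral (\<lambda>t. \<phi>n n (F t)) (\<lambda>s. \<psi>n n (F s) * f s)" for n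
    by (rule indefinite_integral_chain_rule[OF F \<phi>n cont])
  show ?thesis
    unfolding indefinite_integral_def
  proof (intro allI impI conjI)
    fix t :: real assume t: "0 \<le> t"
    have fi: "integrable lborel (\<lambda>s. indicator {0..t} s *\<^sub>R f s)"
      using indefinite_integral_integrable[OF F, of t] by (simp add: set_integrable_def)
    have ni: "integrable lborel (\<lambda>s. indicator {0..t} s *\<^sub>R (\<psi>n n (F s) * f s))" for n
      using indefinite_integral_integrable[OF ch, of t n] by (simp add: set_integrable_def)
    have lim: "(\<lambda>n. indicator {0..t} s *\<^sub>R (\<psi>n n (F s) * f s))
        \<longlonglongrightarrow> indicator {0..t} s *\<^sub>R (\<psi> (F s) * f s)" for s
      by (intro tendsto_intros \<psi>)
    have dom: "AE s in lborel. (\<lambda>n. indicator {0..t} s *\<^sub>R (\<psi>n n (F s) * f s))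
        \<longlonglongrightarrow> indicator {0..t} s *\<^sub>R (\<psi> (F s) * f s)"
      "AE s in lborel. norm (indicator {0..t} s *\<^sub>R (\<psi>n n (F s) * f s))
        \<le> C * \<bar>indicator {0..t} s *\<^sub>R f s\<bar>" for n
      using lim by (auto simp: abs_mult indicator_def intro!: mult_right_mono bound)
    have lm: "(\<lambda>s. indicator {0..t} s *\<^sub>R (\<psi> (F s) * f s)) \<in> borel_measurable lborel"
      by (rule borel_measurable_LIMSEQ_real[OF lim]) (use ni in auto)
    note dc = lm borel_measurable_integrable[OF ni] integrable_mult_right[OF integrable_abs[OF fi]] dom
    show "set_integrable lborel {0..t} (\<lambda>s. \<psi> (F s) * f s)"
      unfolding set_integrable_def by (rule integrable_dominated_convergence[OF dc])
    have "(\<lambda>n. LINT s:{0..t}|lborel. \<psi>n n (F s) * f s) \<longlonglongrightarrow> (LINT s:{0..t}|lborel. \<psi> (F s) * f s)"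
      unfolding set_lebesgue_integral_def by (rule integral_dominated_convergence[OF dc])
    then have "(\<lambda>n. \<phi>n n (F 0) + (LINT s:{0..t}|lborel. \<psi>n n (F s) * f s))
        \<longlonglongrightarrow> \<phi> (F 0) + (LINT s:{0..t}|lborel. \<psi> (F s) * f s)"
      by (intro tendsto_add \<phi>)
    moreover have "\<phi>n n (F 0) + (LINT s:{0..t}|lborel. \<psi>n n (F s) * f s) = \<phi>n n (F t)" for n
      using indefinite_integralD[OF ch t, of n] by linarith
    ultimately have "(\<lambda>n. \<phi>n n (F t)) \<longlonglongrightarrow> \<phi> (F 0) + (LINT s:{0..t}|lborel. \<psi> (F s) * f s)"
      by simp
    with \<phi>[of "F t"] show "\<phi> (F t) = \<phi> (F 0) + (LINT s:{0..t}|lborel. \<psi> (F s) * f s)"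
      by (rule LIMSEQ_unique)
  qed
qed

text \<open>On each \<open>[0,n]\<close> the positive and negative parts of \<open>h\<close> are
  densities of finite measures with the same distribution function. These measures therefore
  coincide, so the integral of \<open>h\<close> over every Borel set vanishes.\<close>

lemma set_integral_Icc_zero_imp_AE_zero:
  fixes h :: "real \<Rightarrow> real"
  assumes int: "\<And>t. set_integrable lborel {0..t} h"
    and zero: "\<And>t. (LINT s:{0..t}|lborel. h s) = 0"
  shows "AE s in lborel. 0 \<le> s \<longrightarrow> h s = 0"
proof -
  have "AE s in lborel. indicator {0..real n} s * h s = 0" for n
  proof (rule sigma_finite_measure.density_zero[OF sigma_finite_lborel])
    let ?h = "\<lambda>s. indicator {0..real n} s * h s"
    show i: "integrable lborel ?h" using int[of n] by (simp add: set_integrable_def)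
    have meas: "?h \<in> borel_measurable borel" using borel_measurable_integrable[OF i] by simp
    let ?P = "density lborel (\<lambda>s. ennreal (max 0 (?h s)))"
    let ?N = "density lborel (\<lambda>s. ennreal (max 0 (- ?h s)))"
    have iP: "integrable lborel (\<lambda>s. max 0 (?h s))" "integrable lborel (\<lambda>s. max 0 (- ?h s))"
      using i by auto
    have em: "emeasure (density lborel (\<lambda>s. ennreal (g s))) A = ennreal (LINT s:A|lborel. g s)"
      if "integrable lborel g" "A \<in> sets borel" "\<And>s. 0 \<le> g s" for g :: "real \<Rightarrow> real" and A
    proof -
      have "emeasure (density lborel (\<lambda>s. ennreal (g s))) A = (\<integral>\<^sup>+s. ennreal (indicator A s * g s) \<partial>lborel)"
        using that by (subst emeasure_density) (auto intro!: nn_integral_cong simp: indicator_def)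
      also have "\<dots> = ennreal (LINT s|lborel. indicator A s * g s)"
        by (rule nn_integral_eq_integral)
          (use that integrable_mult_indicator[of A lborel g] in simp_all)
      finally show ?thesis by (simp add: set_lebesgue_integral_def)
    qed
    have fin: "finite_borel_measure (density lborel (\<lambda>s. ennreal (g s)))"
      if "integrable lborel g" "\<And>s. 0 \<le> g s" for g :: "real \<Rightarrow> real"
      using em[OF that(1) _ that(2), of UNIV]
      by (intro finite_borel_measure.intro finite_measureI finite_borel_measure_axioms.intro) auto
    have emP: "emeasure ?P A = ennreal (LINT s:A|lborel. max 0 (?h s))"
      and emN: "emeasure ?N A = ennreal (LINT s:A|lborel. max 0 (- ?h s))" if "A \<in> sets borel" for A
      by (rule em[OF iP(1) that] em[OF iP(2) that], rule max.cobounded1)+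
    have sub: "(LINT s:A|lborel. ?h s) = (LINT s:A|lborel. max 0 (?h s)) - (LINT s:A|lborel. max 0 (- ?h s))"
      if "A \<in> sets borel" for A
    proof -
      have "set_integrable lborel A (\<lambda>s. max 0 (?h s))" "set_integrable lborel A (\<lambda>s. max 0 (- ?h s))"
        unfolding set_integrable_def
        by (rule integrable_mult_indicator, use that in simp, rule iP)+
      from set_integral_diff(2)[OF this]
      have "(LINT s:A|lborel. max 0 (?h s)) - (LINT s:A|lborel. max 0 (- ?h s))
        = (LINT s:A|lborel. max 0 (?h s) - max 0 (- ?h s))" by simp
      also have "\<dots> = (LINT s:A|lborel. ?h s)"
        by (intro set_lebesgue_integral_cong) (use that in auto)
      finally show ?thesis by simp
    qed
    have "?P = ?N"
    proof (rule cdf_unique')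
      show "finite_borel_measure ?P" by (rule fin[OF iP(1)]) (rule max.cobounded1)
      show "finite_borel_measure ?N" by (rule fin[OF iP(2)]) (rule max.cobounded1)
      show "cdf ?P = cdf ?N"
      proof
        fix x :: real
        have "(LINT s:{..x}|lborel. ?h s) = (LINT s:{0..min x n}|lborel. h s)"
          unfolding set_lebesgue_integral_def by (intro Bochner_Integration.integral_cong) (auto simp: indicator_def)
        then have "(LINT s:{..x}|lborel. max 0 (?h s)) = (LINT s:{..x}|lborel. max 0 (- ?h s))"
          using zero sub[of "{..x}"] by simp
        then show "cdf ?P x = cdf ?N x"
          unfolding cdf_def measure_def by (simp only: emP emN atMost_borel)
      qed
    qed
    fix A assume A: "A \<in> sets (lborel :: real measure)"
    have nn: "0 \<le> (LINT s:A|lborel. max 0 (g s))" for g :: "real \<Rightarrow> real"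
      unfolding set_lebesgue_integral_def by (rule integral_nonneg_AE) (auto intro!: AE_I2)
    have "emeasure ?P A = emeasure ?N A" by (rule arg_cong[OF \<open>?P = ?N\<close>])
    then show "(LINT s:A|lborel. ?h s) = 0"
      using A nn[of ?h] nn[of "\<lambda>s. - ?h s"] emP[of A] emN[of A] sub[of A]
      by simp
  qed
  then have "AE s in lborel. \<forall>n. indicator {0..real n} s * h s = 0"
    unfolding AE_all_countable by blast
  then show ?thesis
  proof eventually_elim
    case (elim s)
    obtain n where "s \<le> real n" using real_arch_simple by blast
    then show ?case using elim[rule_format, of n] by (auto simp: indicator_def split: if_splits)
  qed
qed

text \<open>The functions \<open>arctan (n x) / n\<close> tend to 0, and their derivatives to the indicator of 0.\<close>

lemma indefinite_integral_level_set:
  assumes F: "indefinite_integral F f"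
  shows "AE s in lborel. 0 \<le> s \<longrightarrow> F s = c \<longrightarrow> f s = 0"
proof -
  have 1: "((\<lambda>x. arctan (real (Suc n) * (x - c)) / real (Suc n)) has_real_derivative
      1 / (1 + (real (Suc n) * (x - c))\<^sup>2)) (at x)" for n x
  proof -
    define k where "k = real (Suc n)"
    have "k > 0" "1 + (k * (x - c))\<^sup>2 > 0" by (auto simp: k_def add_pos_nonneg)
    then have "((\<lambda>x. arctan (k * (x - c)) / k) has_real_derivative 1 / (1 + (k * (x - c))\<^sup>2)) (at x)"
      by (auto intro!: derivative_eq_intros simp: divide_inverse)
    then show ?thesis by (simp add: k_def)
  qed
  have 2: "(\<lambda>n. arctan (real (Suc n) * (x - c)) / real (Suc n)) \<longlonglongrightarrow> 0" for x
  proof (rule Lim_null_comparison[OF always_eventually])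
    have "\<bar>arctan y\<bar> \<le> 2" for y using arctan_bounded[of y] pi_less_4 by (auto simp: abs_if)
    then show "\<forall>n. norm (arctan (real (Suc n) * (x - c)) / real (Suc n)) \<le> 2 * inverse (real (Suc n))"
      by (auto simp: divide_simps)
    show "(\<lambda>n. 2 * inverse (real (Suc n))) \<longlonglongrightarrow> 0"
      using tendsto_mult_right_zero[OF LIMSEQ_inverse_real_of_nat] by simp
  qed
  have 3: "(\<lambda>n. 1 / (1 + (real (Suc n) * (x - c))\<^sup>2)) \<longlonglongrightarrow> indicator {c} x" for x
  proof (cases "x = c")
    case False
    have "filterlim (\<lambda>n. real (Suc n)) at_top sequentially"
      by (rule filterlim_compose[OF filterlim_real_sequentially filterlim_Suc])
    then have "filterlim (\<lambda>n. (real (Suc n))\<^sup>2 * (x-c)\<^sup>2) at_top sequentially"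
      using False by (intro filterlim_at_top_mult_tendsto_pos[OF tendsto_const] filterlim_pow_at_top) auto
    then have "filterlim (\<lambda>n. 1 + (real (Suc n) * (x - c))\<^sup>2) at_top sequentially"
      by (intro filterlim_tendsto_add_at_top[OF tendsto_const]) (simp add: power_mult_distrib)
    then have "(\<lambda>n. 1 / (1 + (real (Suc n) * (x - c))\<^sup>2)) \<longlonglongrightarrow> 0"
      by (intro real_tendsto_divide_at_top[OF tendsto_const])
    then show ?thesis using False by simp
  qed simp
  \<comment> \<open>The limiting primitive is identically 0, so the integrals of \<open>f\<close>
    over the parts of \<open>{F = c}\<close> in \<open>[0,t]\<close> all vanish.\<close>
  have I: "indefinite_integral (\<lambda>t. 0) (\<lambda>s. indicator {c} (F s) * f s)"
  proof (rule indefinite_integral_chain_rule_limit[OF F 1 _ _ 2 3, where C=1])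
    show "continuous_on UNIV (\<lambda>x. 1 / (1 + (real (Suc n) * (x - c))\<^sup>2))" for n
      by (intro continuous_intros) (auto simp: add_nonneg_eq_0_iff)
    show "\<bar>1 / (1 + (real (Suc n) * (x - c))\<^sup>2)\<bar> \<le> 1" for n x
      by (simp add: divide_simps add_pos_nonneg abs_if)
  qed
  have "AE s in lborel. 0 \<le> s \<longrightarrow> indicator {c} (F s) * f s = 0"
  proof (rule set_integral_Icc_zero_imp_AE_zero)
    show "set_integrable lborel {0..t} (\<lambda>s. indicator {c} (F s) * f s)" for t
      by (rule indefinite_integral_integrable[OF I])
    show "(LINT s:{0..t}|lborel. indicator {c} (F s) * f s) = 0" for t
      using indefinite_integralD[OF I, of t] by (cases "0 \<le> t") (auto simp: set_lebesgue_integral_def)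
  qed
  then show ?thesis by eventually_elim auto
qed

text \<open>The absolute value is smoothed to \<open>sqrt ((x - c)\<^sup>2 + 1/(n+1))\<close>, whose
  derivative is bounded by 1 and is 0 at \<open>c\<close> for every \<open>n\<close>, in agreement
  with \<open>sgn 0 = 0\<close>.\<close>

lemma indefinite_integral_abs:
  assumes F: "indefinite_integral F f"
  shows "indefinite_integral (\<lambda>t. \<bar>F t - c\<bar>) (\<lambda>s. sgn (F s - c) * f s)"
proof (rule indefinite_integral_chain_rule_limit[OF F, where C=1
      and \<phi>n="\<lambda>n x. sqrt ((x - c)\<^sup>2 + inverse (real (Suc n)))"
      and \<psi>n="\<lambda>n x. (x - c) / sqrt ((x - c)\<^sup>2 + inverse (real (Suc n)))"])
  have pos: "0 < (x - c)\<^sup>2 + inverse (real (Suc n))" for n x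
    by (intro add_nonneg_pos) auto
  show "((\<lambda>x. sqrt ((x - c)\<^sup>2 + inverse (real (Suc n)))) has_real_derivative
      (x - c) / sqrt ((x - c)\<^sup>2 + inverse (real (Suc n)))) (at x)" for n x
  proof -
    define r where "r = inverse (real (Suc n))"
    have "0 < (x - c)\<^sup>2 + r" unfolding r_def by (rule pos)
    then have "((\<lambda>x. sqrt ((x - c)\<^sup>2 + r)) has_real_derivative (x - c) / sqrt ((x - c)\<^sup>2 + r)) (at x)"
      by (auto intro!: derivative_eq_intros simp: field_simps)
    then show ?thesis by (simp add: r_def)
  qed
  show "continuous_on UNIV (\<lambda>x. (x - c) / sqrt ((x - c)\<^sup>2 + inverse (real (Suc n))))" for n
    using pos by (intro continuous_intros) (auto simp: less_le)
  show "\<bar>(x - c) / sqrt ((x - c)\<^sup>2 + inverse (real (Suc n)))\<bar> \<le> 1" for n x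
  proof -
    have "\<bar>x - c\<bar> \<le> sqrt ((x - c)\<^sup>2 + inverse (real (Suc n)))"
      by (rule real_le_rsqrt) auto
    then show ?thesis using pos[of x n] by (auto simp: abs_divide divide_simps)
  qed
  have lim: "(\<lambda>n. sqrt ((x - c)\<^sup>2 + inverse (real (Suc n)))) \<longlonglongrightarrow> \<bar>x - c\<bar>" for x
    using tendsto_real_sqrt[OF tendsto_add[OF tendsto_const[of "(x-c)\<^sup>2"] LIMSEQ_inverse_real_of_nat]]
    by simp
  then show "(\<lambda>n. sqrt ((x - c)\<^sup>2 + inverse (real (Suc n)))) \<longlonglongrightarrow> \<bar>x - c\<bar>" for x .
  show "(\<lambda>n. (x - c) / sqrt ((x - c)\<^sup>2 + inverse (real (Suc n)))) \<longlonglongrightarrow> sgn (x - c)" for x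
  proof (cases "x = c")
    case False
    have "(\<lambda>n. (x - c) / sqrt ((x - c)\<^sup>2 + inverse (real (Suc n)))) \<longlonglongrightarrow> (x - c) / \<bar>x - c\<bar>"
      using False by (intro tendsto_divide tendsto_const lim) auto
    also have "(x - c) / \<bar>x - c\<bar> = sgn (x - c)" using False by (auto simp: sgn_real_def abs_if divide_simps)
    finally show ?thesis .
  qed simp
qed

text \<open>Equality almost everywhere does not transfer Borel measurability, so measurability of
  \<open>g\<close> is a separate premise.\<close>

lemma indefinite_integral_cong_AE:
  assumes F: "indefinite_integral F f" and eq: "AE s in lborel. 0 \<le> s \<longrightarrow> f s = g s"
    and g: "\<And>t. (\<lambda>s. indicator {0..t} s * g s) \<in> borel_measurable lborel"
    and FG: "\<And>t. 0 \<le> t \<Longrightarrow> F t = G t"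
  shows "indefinite_integral G g"
  unfolding indefinite_integral_def
proof (intro allI impI conjI)
  fix t :: real assume t: "0 \<le> t"
  have i: "integrable lborel (\<lambda>s. indicator {0..t} s *\<^sub>R f s)"
    using indefinite_integral_integrable[OF F, of t] by (simp add: set_integrable_def)
  have ae: "AE s in lborel. indicator {0..t} s *\<^sub>R f s = indicator {0..t} s *\<^sub>R g s"
    using eq by eventually_elim (auto simp: indicator_def)
  have m: "(\<lambda>s. indicator {0..t} s *\<^sub>R g s) \<in> borel_measurable lborel" using g by simp
  show "set_integrable lborel {0..t} g"
    unfolding set_integrable_def by (rule integrable_cong_AE_imp[OF i m]) (use ae in eventually_elim, simp)
  have "(LINT s:{0..t}|lborel. f s) = (LINT s:{0..t}|lborel. g s)"
    unfolding set_lebesgue_integral_def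
    by (rule integral_cong_AE[OF borel_measurable_integrable[OF i] m ae])
  then show "G t = G 0 + (LINT s:{0..t}|lborel. g s)"
    using indefinite_integralD[OF F t] FG[OF t] FG[of 0] by simp
qed

text \<open>The positive part is half of the sum of the identity and the absolute value, up to a
  constant. The resulting derivative is \<open>f s / 2\<close> instead of 0 where
  \<open>F s = c\<close>, but there \<open>f\<close> vanishes almost everywhere by the level set
  lemma.\<close>

lemma indefinite_integral_excess:
  assumes F: "indefinite_integral F f"
  shows "indefinite_integral (\<lambda>t. max (F t - c) 0) (\<lambda>s. indicator {c<..} (F s) * f s)"
proof -
  have I: "indefinite_integral (\<lambda>t. (1/2) * (F t + \<bar>F t - c\<bar>)) (\<lambda>s. (1/2) * (f s + sgn (F s - c) * f s))"
    by (intro indefinite_integral_cmult indefinite_integral_add[OF F] indefinite_integral_abs F)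
  have max_half: "max (y - c) 0 = (1/2) * (y + \<bar>y - c\<bar>) - c / 2" for y :: real
    by (cases "y \<le> c") (auto simp: max_def field_simps)
  have I2: "indefinite_integral (\<lambda>t. max (F t - c) 0) (\<lambda>s. (1/2) * (f s + sgn (F s - c) * f s))"
    unfolding indefinite_integral_def
  proof (intro allI impI conjI)
    fix t :: real assume t: "0 \<le> t"
    show "set_integrable lborel {0..t} (\<lambda>s. (1/2) * (f s + sgn (F s - c) * f s))"
      by (rule indefinite_integral_integrable[OF I])
    show "max (F t - c) 0 = max (F 0 - c) 0 + (LINT s:{0..t}|lborel. (1/2) * (f s + sgn (F s - c) * f s))"
      using indefinite_integralD[OF I t] max_half[of "F t"] max_half[of "F 0"] by linarith
  qed
  show ?thesis
  proof (rule indefinite_integral_cong_AE[OF I2])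
    show "AE s in lborel. 0 \<le> s \<longrightarrow>
        (1/2) * (f s + sgn (F s - c) * f s) = indicator {c<..} (F s) * f s"
      using indefinite_integral_level_set[OF F, of c]
      by eventually_elim (auto simp: sgn_real_def indicator_def)
    fix t
    have [measurable]: "(\<lambda>s. indicator {0..t} s * F s) \<in> borel_measurable lborel"
      by (rule continuous_on_set_measurable[OF indefinite_integral_continuous[OF F]])
    have [measurable]: "(\<lambda>s. indicator {0..t} s * f s) \<in> borel_measurable lborel"
      using indefinite_integral_integrable[OF F, of t] by (auto simp: set_integrable_def)
    have "(\<lambda>s. indicator {c<..} (indicator {0..t} s * F s) * (indicator {0..t} s * f s)) \<in> borel_measurable lborel"
      by measurable
    also have "(\<lambda>s. indicator {c<..} (indicator {0..t} s * F s) * (indicator {0..t} s * f s))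
        = (\<lambda>s. indicator {0..t} s * (indicator {c<..} (F s) * f s))"
      by (auto simp: indicator_def)
    finally show "(\<lambda>s. indicator {0..t} s * (indicator {c<..} (F s) * f s)) \<in> borel_measurable lborel" .
  qed auto
qed

section \<open>Rates and laws with a density\<close>

lemma nn_integral_set_eq_integral:
  fixes f :: "'a \<Rightarrow> real"
  assumes "set_integrable M A f" "\<And>x. x \<in> A \<Longrightarrow> 0 \<le> f x"
  shows "(\<integral>\<^sup>+x\<in>A. ennreal (f x) \<partial>M) = ennreal (LINT x:A|M. f x)"
proof -
  have "(\<integral>\<^sup>+x\<in>A. ennreal (f x) \<partial>M) = (\<integral>\<^sup>+x. ennreal (indicator A x *\<^sub>R f x) \<partial>M)"
    by (intro nn_integral_cong) (auto simp: indicator_def)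
  also have "\<dots> = ennreal (LINT x:A|M. f x)"
    unfolding set_lebesgue_integral_def
    by (rule nn_integral_eq_integral)
      (use assms in \<open>auto simp: set_integrable_def indicator_def\<close>)
  finally show ?thesis .
qed

lemma indefinite_integral_measurable:
  assumes "indefinite_integral F f"
  shows "(\<lambda>s. indicator {0..} s * f s) \<in> borel_measurable borel"
proof (rule borel_measurable_LIMSEQ_real)
  show "(\<lambda>s. indicator {0..real n} s * f s) \<in> borel_measurable borel" for n
    using borel_measurable_integrable[OF indefinite_integral_integrable[OF assms, unfolded set_integrable_def, of "real n"]]
    by simp
  fix s :: real
  obtain N where "s \<le> real N" using real_arch_simple by blast
  then have "\<forall>\<^sub>F n in sequentially. indicator {0..real n} s * f s = indicator {0..} s * f s"
    by (intro eventually_sequentiallyI[of N]) (auto simp: indicator_def)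
  then show "(\<lambda>n. indicator {0..real n} s * f s) \<longlonglongrightarrow> indicator {0..} s * f s"
    by (rule tendsto_eventually)
qed

lemma locally_integrable_rate_measurable:
  assumes "locally_integrable_rate r"
  shows "(\<lambda>s. r s * indicator {0..} s) \<in> borel_measurable borel"
  using assms unfolding locally_integrable_rate_def
  by (subst (asm) borel_measurable_restrict_space_iff_ennreal) auto

lemma locally_integrable_rate_AE_finite:
  assumes "locally_integrable_rate r"
  shows "AE s in lborel. 0 \<le> s \<longrightarrow> r s < \<infinity>"
proof -
  have "AE s in lborel. r s * indicator {0..real n} s \<noteq> \<infinity>" for n
  proof (rule nn_integral_PInf_AE)
    have "(\<lambda>s. (r s * indicator {0..} s) * indicator {..real n} s) \<in> borel_measurable borel"
      using locally_integrable_rate_measurable[OF assms] by measurable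
    also have "(\<lambda>s. (r s * indicator {0..} s) * indicator {..real n} s)
        = (\<lambda>s. r s * indicator {0..real n} s)"
      by (auto simp: indicator_def)
    finally show "(\<lambda>s. r s * indicator {0..real n} s) \<in> borel_measurable lborel" by simp
    have "(\<integral>\<^sup>+ s\<in>{0..real n}. r s \<partial>lborel) < \<infinity>"
      using assms unfolding locally_integrable_rate_def by (meson of_nat_0_le_iff)
    then show "(\<integral>\<^sup>+ s\<in>{0..real n}. r s \<partial>lborel) \<noteq> \<infinity>" by simp
  qed
  then have "AE s in lborel. \<forall>n. r s * indicator {0..real n} s \<noteq> \<infinity>"
    unfolding AE_all_countable by blast
  then show ?thesis
  proof eventually_elim
    case (elim s)
    obtain n where "s \<le> real n" using real_arch_simple by blast
    then show ?case using elim[rule_format, of n]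
      by (auto simp: indicator_def top.not_eq_extremum split: if_splits)
  qed
qed

lemma cumulative_0: "cumulative r 0 = 0"
proof -
  have "(\<integral>\<^sup>+s. r s * indicator {0..0} s \<partial>lborel) = (\<integral>\<^sup>+s. 0 \<partial>(lborel :: real measure))"
    by (rule nn_integral_cong_AE, use AE_lborel_singleton[of "0::real"] in eventually_elim) auto
  then show ?thesis by (simp add: cumulative_def)
qed

text \<open>Where \<open>r\<close> is infinite, \<open>enn2real\<close> returns 0; local
  integrability confines this to a null set.\<close>

lemma indefinite_integral_cumulative:
  assumes r: "locally_integrable_rate r"
  shows "indefinite_integral (cumulative r) (\<lambda>s. enn2real (r s))"
proof -
  show ?thesis unfolding indefinite_integral_def
  proof (intro allI impI conjI)
    fix t :: real assume t: "0 \<le> t"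
    have "(\<lambda>s. (r s * indicator {0..} s) * indicator {..t} s) \<in> borel_measurable borel"
      using locally_integrable_rate_measurable[OF r] by measurable
    also have "(\<lambda>s. (r s * indicator {0..} s) * indicator {..t} s) = (\<lambda>s. r s * indicator {0..t} s)"
      by (auto simp: indicator_def)
    finally have m: "(\<lambda>s. r s * indicator {0..t} s) \<in> borel_measurable borel" .
    then have "(\<lambda>s. enn2real (r s * indicator {0..t} s)) \<in> borel_measurable borel" by measurable
    also have e: "(\<lambda>s. enn2real (r s * indicator {0..t} s)) = (\<lambda>s. indicator {0..t} s *\<^sub>R enn2real (r s))"
      by (auto simp: indicator_def)
    finally have m2: "(\<lambda>s. indicator {0..t} s *\<^sub>R enn2real (r s)) \<in> borel_measurable lborel" by simp
    have nn: "(\<integral>\<^sup>+s. ennreal (indicator {0..t} s *\<^sub>R enn2real (r s)) \<partial>lborel)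
        = (\<integral>\<^sup>+s\<in>{0..t}. r s \<partial>lborel)"
    proof (rule nn_integral_cong_AE)
      show "AE s in lborel. ennreal (indicator {0..t} s *\<^sub>R enn2real (r s)) = r s * indicator {0..t} s"
        using locally_integrable_rate_AE_finite[OF r]
        by eventually_elim (auto simp: indicator_def)
    qed
    have fin: "(\<integral>\<^sup>+s\<in>{0..t}. r s \<partial>lborel) < \<infinity>"
      using r t by (auto simp: locally_integrable_rate_def)
    show "set_integrable lborel {0..t} (\<lambda>s. enn2real (r s))"
      unfolding set_integrable_def
      by (rule integrableI_nonneg[OF m2]) (use nn fin in auto)
    have "(LINT s:{0..t}|lborel. enn2real (r s)) = cumulative r t"
      unfolding set_lebesgue_integral_def cumulative_def nn[symmetric]
      by (rule integral_eq_nn_integral[OF m2]) auto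
    then show "cumulative r t = cumulative r 0 + (LINT s:{0..t}|lborel. enn2real (r s))"
      by (simp add: cumulative_0)
  qed
qed

section \<open>Measures on the ages with a density\<close>

definition age_law :: "(real \<Rightarrow> real) \<Rightarrow> real measure" where
  "age_law f = density lborel (\<lambda>x. ennreal (f x) * indicator {0..} x)"

lemma age_law_alt: "age_law f = density lborel (\<lambda>x. ennreal (indicator {0..} x * f x))"
  unfolding age_law_def by (rule arg_cong[of _ _ "density lborel"]) (auto simp: indicator_def)

lemma sets_age_law [simp, measurable_cong]: "sets (age_law f) = sets borel"
  and space_age_law [simp]: "space (age_law f) = UNIV"
  by (simp_all add: age_law_def)

lemma set_borel_measurable_Ici:
  fixes f :: "real \<Rightarrow> real"
  assumes "set_integrable lborel {0..} f"
  shows "(\<lambda>x. indicator {0..} x * f x) \<in> borel_measurable borel"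
  using borel_measurable_integrable[OF assms[unfolded set_integrable_def]] by simp

lemma emeasure_age_law:
  assumes f: "set_integrable lborel {0..} f" "\<And>x. 0 \<le> x \<Longrightarrow> 0 \<le> f x"
    and A: "A \<in> sets borel" "A \<subseteq> {0..}"
  shows "emeasure (age_law f) A = ennreal (LINT x:A|lborel. f x)"
proof -
  have "emeasure (age_law f) A = (\<integral>\<^sup>+x\<in>A. ennreal (indicator {0..} x * f x) \<partial>lborel)"
    unfolding age_law_alt using A set_borel_measurable_Ici[OF f(1)]
    by (subst emeasure_density) auto
  also have "\<dots> = (\<integral>\<^sup>+x\<in>A. ennreal (f x) \<partial>lborel)"
    using A by (intro nn_integral_cong) (auto simp: indicator_def)
  also have "\<dots> = ennreal (LINT x:A|lborel. f x)"
    using A f by (intro nn_integral_set_eq_integral set_integrable_subset[OF f(1)]) auto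
  finally show ?thesis .
qed

lemma measure_age_law:
  assumes f: "set_integrable lborel {0..} f" "\<And>x. 0 \<le> x \<Longrightarrow> 0 \<le> f x"
    and A: "A \<in> sets borel" "A \<subseteq> {0..}"
  shows "measure (age_law f) A = (LINT x:A|lborel. f x)"
proof -
  have "0 \<le> (LINT x:A|lborel. f x)"
    unfolding set_lebesgue_integral_def
    by (rule integral_nonneg_AE) (use A f in \<open>auto simp: indicator_def\<close>)
  then show ?thesis by (simp add: measure_def emeasure_age_law[OF f A])
qed

lemma emeasure_age_law_negative:
  assumes f: "set_integrable lborel {0..} f"
  shows "emeasure (age_law f) (- {0..}) = 0"
  unfolding age_law_alt using set_borel_measurable_Ici[OF f]
  by (subst emeasure_density) (auto simp: nn_integral_0_iff_AE indicator_def)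

lemma finite_borel_measure_age_law:
  assumes f: "set_integrable lborel {0..} f" "\<And>x. 0 \<le> x \<Longrightarrow> 0 \<le> f x"
  shows "finite_borel_measure (age_law f)"
proof (intro finite_borel_measure.intro finite_measureI finite_borel_measure_axioms.intro)
  have "emeasure (age_law f) UNIV \<le> emeasure (age_law f) {0..} + emeasure (age_law f) (- {0..})"
    using emeasure_subadditive[of "{0..}" "age_law f" "- {0..}"] by (simp add: Compl_partition del: Compl_atLeast)
  then show "emeasure (age_law f) (space (age_law f)) \<noteq> \<infinity>"
    using emeasure_age_law_negative[OF f(1)] emeasure_age_law[OF f, of "{0..}"]
    by (auto simp: top_unique)
qed simp

text \<open>Both measures give \<open>(a,b]\<close> the increment of \<open>K\<close>, and these
  intervals form an intersection-stable generator. Nonnegativity of \<open>k\<close> makes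
  \<open>K\<close> nondecreasing, so that \<open>interval_measure\<close> is the Stieltjes
  measure.\<close>

lemma interval_measure_indefinite_integral:
  assumes K: "indefinite_integral K k" and k: "\<And>s. 0 \<le> s \<Longrightarrow> 0 \<le> k s"
  shows "interval_measure (\<lambda>s. K (max 0 s)) = age_law k"
proof -
  let ?K = "\<lambda>s. K (max 0 s)"
  have mono: "?K x \<le> ?K y" if "x \<le> y" for x y
  proof -
    have "0 \<le> (LINT s:{max 0 x<..max 0 y}|lborel. k s)"
      unfolding set_lebesgue_integral_def
      by (rule integral_nonneg_AE) (auto simp: indicator_def intro!: k)
    then show ?thesis
      using indefinite_integral_increment[OF K max.cobounded1 max.mono[OF order_refl that]] by linarith
  qed
  have "continuous_on UNIV ?K"
    by (rule continuous_on_compose2[OF indefinite_integral_continuous[OF K]]) (auto intro!: continuous_intros)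
  then have rc: "continuous (at_right a) ?K" for a
    using continuous_at_imp_continuous_within by (auto simp: continuous_on_eq_continuous_at)
  have int: "emeasure (interval_measure ?K) {a<..b} = ennreal (?K b - ?K a)" if "a \<le> b" for a b
    by (rule emeasure_interval_measure_Ioc[OF that mono rc])
  have dens: "emeasure (age_law k) {a<..b} = ennreal (?K b - ?K a)" if "a \<le> b" for a b
  proof -
    have "emeasure (age_law k) {a<..b} = (\<integral>\<^sup>+x\<in>{a<..b}. ennreal (indicator {0..} x * k x) \<partial>lborel)"
      unfolding age_law_alt using indefinite_integral_measurable[OF K]
      by (subst emeasure_density) auto
    \<comment> \<open>The two integrands differ at most at 0, which \<open>(a,b]\<close> contains
      for negative \<open>a\<close> and nonnegative \<open>b\<close>, while
      \<open>(max 0 a, max 0 b]\<close> does not.\<close>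
    also have "\<dots> = (\<integral>\<^sup>+x\<in>{max 0 a<..max 0 b}. ennreal (k x) \<partial>lborel)"
    proof (rule nn_integral_cong_AE)
      show "AE x in lborel. ennreal (indicator {0..} x * k x) * indicator {a<..b} x
          = ennreal (k x) * indicator {max 0 a<..max 0 b} x"
        using AE_lborel_singleton[of "0::real"]
        by eventually_elim (auto simp: indicator_def)
    qed
    also have "\<dots> = ennreal (LINT x:{max 0 a<..max 0 b}|lborel. k x)"
      by (intro nn_integral_set_eq_integral set_integrable_subset[OF indefinite_integral_integrable[OF K, of "max 0 b"]])
        (auto intro!: k)
    also have "\<dots> = ennreal (?K b - ?K a)"
      using indefinite_integral_increment[OF K, of "max 0 a" "max 0 b"] that by simp
    finally show ?thesis .
  qed
  show ?thesis
  proof (rule measure_eqI_generator_eq[where \<Omega>=UNIV and E="range (\<lambda>(a, b). {a<..b::real})" and A="\<lambda>i. {- real i<..real i}"])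
    fix X assume "X \<in> range (\<lambda>(a, b). {a<..b::real})"
    then obtain a b where "X = {a<..b}" by auto
    then show "emeasure (interval_measure ?K) X = emeasure (age_law k) X"
      by (cases "a \<le> b") (simp_all add: int dens)
  next
    show "(\<Union>i. {- real i<..real i}) = UNIV" by (rule UN_Ioc_eq_UNIV)
    show "emeasure (interval_measure ?K) {- real i<..real i} \<noteq> \<infinity>" for i
      by (simp add: int)
  qed (auto simp: borel_sigma_sets_Ioc Int_stable_def)
qed

text \<open>\<open>cts_step a b\<close> is 1 up to \<open>a\<close>, 0 from \<open>b\<close> on and
  linear between, hence lies between the indicators of \<open>{..a}\<close> and
  \<open>{..b}\<close>.\<close>

lemma (in finite_borel_measure) cdf_cts_step_bounds:
  assumes "a < b"
  shows "cdf M a \<le> (LINT x|M. cts_step a b x)" "(LINT x|M. cts_step a b x) \<le> cdf M b"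
proof -
  have [measurable]: "cts_step a b \<in> borel_measurable borel"
    by (rule borel_measurable_continuous_onI)
      (rule uniformly_continuous_imp_continuous[OF cts_step_uniformly_continuous[OF assms]])
  have M: "cts_step a b \<in> borel_measurable M" 
    using M_is_borel by (simp cong: measurable_cong_sets)
  have i: "integrable M (cts_step a b)"
    by (rule integrable_const_bound[of _ 1, OF _ M]) (use assms in \<open>auto simp: cts_step_def divide_simps\<close>)
  have j: "integrable M (indicator {..x::real} :: real \<Rightarrow> real)" for x
    by (rule integrable_real_indicator) (auto simp: less_top[symmetric])
  have m: "measure M {..x} = (LINT y|M. indicator {..x} y)" for x
    by (simp add: borel_UNIV)
  show "cdf M a \<le> (LINT x|M. cts_step a b x)"
    unfolding cdf_def m using assms
    by (intro integral_mono i j) (auto simp: cts_step_def indicator_def)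
  show "(LINT x|M. cts_step a b x) \<le> cdf M b"
    unfolding cdf_def m using assms
    by (intro integral_mono i j) (auto simp: cts_step_def indicator_def)
qed

text \<open>The ramps \<open>cts_step a b\<close> are admissible test functions and sandwich the
  distribution functions: one at \<open>a\<close> is at most the other at any \<open>b > a\<close>.
  Letting \<open>b\<close> decrease to \<open>a\<close> and exchanging roles gives equality.
  Restricting to values in \<open>[0,1]\<close> allows the test integrals to be evaluated later as
  nonnegative ones.\<close>

lemma measure_eq_age_lawI:
  assumes M: "sets M = sets borel" "finite_measure M" "emeasure M (- {0..}) = 0"
    and f: "set_integrable lborel {0..} f" "\<And>x. 0 \<le> x \<Longrightarrow> 0 \<le> f x"
    and eq: "\<And>\<psi> :: real \<Rightarrow> real. continuous_on UNIV \<psi> \<Longrightarrow> (\<And>x. 0 \<le> \<psi> x \<and> \<psi> x \<le> 1) \<Longrightarrow>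
      (LINT x:{0..}|M. \<psi> x) = (LINT x:{0..}|lborel. \<psi> x * f x)"
  shows "M = age_law f"
proof -
  interpret M: finite_borel_measure M
    using M by (simp add: finite_borel_measure_def finite_borel_measure_axioms_def)
  interpret N: finite_borel_measure "age_law f"
    by (rule finite_borel_measure_age_law[OF f])
  have step: "(LINT x|M. cts_step a b x) = (LINT x|age_law f. cts_step a b x)" if "a < b" for a b
  proof -
    have c: "continuous_on UNIV (cts_step a b)"
      by (rule uniformly_continuous_imp_continuous[OF cts_step_uniformly_continuous[OF that]])
    have [measurable]: "cts_step a b \<in> borel_measurable borel"
      by (rule borel_measurable_continuous_onI[OF c])
    have mM: "cts_step a b \<in> borel_measurable M"
      using M(1) by (simp cong: measurable_cong_sets)
    have "AE x in M. x \<in> {0..}"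
      by (rule AE_I[where N="- {0..}"]) (use M in auto)
    then have "(LINT x|M. cts_step a b x) = (LINT x:{0..}|M. cts_step a b x)"
      unfolding set_lebesgue_integral_def
      by (intro integral_cong_AE) (use mM M(1) in \<open>auto intro!: borel_measurable_times borel_measurable_indicator\<close>)
    also have "\<dots> = (LINT x:{0..}|lborel. cts_step a b x * f x)"
      by (rule eq[OF c]) (use that in \<open>auto simp: cts_step_def divide_simps\<close>)
    also have "\<dots> = (LINT x|lborel. (indicator {0..} x * f x) *\<^sub>R cts_step a b x)"
      unfolding set_lebesgue_integral_def by (intro Bochner_Integration.integral_cong) auto
    also have "\<dots> = (LINT x|age_law f. cts_step a b x)"
      unfolding age_law_alt using set_borel_measurable_Ici[OF f(1)]
      by (intro integral_density[symmetric]) (auto simp: indicator_def intro!: f(2))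
    finally show ?thesis .
  qed
  have le: "cdf M1 a \<le> cdf M2 a"
    if "finite_borel_measure M1" "finite_borel_measure M2"
      "\<And>a b. a < b \<Longrightarrow> (LINT x|M1. cts_step a b x) = (LINT x|M2. cts_step a b x)" for M1 M2 and a
  proof -
    have *: "cdf M1 a \<le> cdf M2 b" if "a < b" for b
      using finite_borel_measure.cdf_cts_step_bounds[OF \<open>finite_borel_measure M1\<close> that]
        finite_borel_measure.cdf_cts_step_bounds[OF \<open>finite_borel_measure M2\<close> that]
        \<open>\<And>a b. a < b \<Longrightarrow> (LINT x|M1. cts_step a b x) = (LINT x|M2. cts_step a b x)\<close>[OF that] by simp
    have "(cdf M2 \<longlongrightarrow> cdf M2 a) (at_right a)"
      using finite_borel_measure.cdf_is_right_cont[OF that(2), of a] by (simp add: continuous_within)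
    then show ?thesis
      by (rule tendsto_lowerbound) (use * in \<open>auto simp: eventually_at_filter\<close>)
  qed
  show ?thesis
    by (rule cdf_unique'[OF M.finite_borel_measure_axioms N.finite_borel_measure_axioms])
      (intro ext antisym le M.finite_borel_measure_axioms N.finite_borel_measure_axioms, simp_all add: step)
qed

section \<open>Ageing populations\<close>

locale lifetime =
  fixes G g :: "real \<Rightarrow> real"
  assumes law: "lifetime_law G g"
begin

abbreviation "P \<equiv> density lborel (\<lambda>x. ennreal (g x))"

lemma g_measurable [measurable]: "g \<in> borel_measurable borel"
  and g_nonneg: "0 \<le> g x"
  and g_negative: "x < 0 \<Longrightarrow> g x = 0"
  and G_eq: "G = cdf P"
  using law by (auto simp: lifetime_law_def)

sublocale P: prob_space P
  using law by (auto simp: lifetime_law_def)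

sublocale P: finite_borel_measure P
  by standard simp

lemma measure_P_singleton: "measure P {x} = 0"
proof -
  have "emeasure P {x} = (\<integral>\<^sup>+y\<in>{x}. ennreal (g y) \<partial>lborel)"
    by (simp add: emeasure_density)
  also have "\<dots> = (\<integral>\<^sup>+y. 0 \<partial>(lborel :: real measure))"
    by (rule nn_integral_cong_AE, use AE_lborel_singleton[of x] in eventually_elim) auto
  finally show ?thesis by (simp add: measure_def)
qed

lemma continuous_surv: "continuous_on A (surv G)"
  unfolding surv_def[abs_def] G_eq
  using P.isCont_cdf measure_P_singleton
  by (intro continuous_intros continuous_at_imp_continuous_on) auto

lemma surv_measurable [measurable]: "surv G \<in> borel_measurable borel"
  by (rule borel_measurable_continuous_onI[OF continuous_surv])

lemma surv_le_1: "surv G x \<le> 1" and surv_nonneg: "0 \<le> surv G x"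
  using P.cdf_nonneg[of x] P.prob_le_1[of "{..x}"] by (auto simp: surv_def G_eq cdf_def)

lemma surv_antimono: "x \<le> y \<Longrightarrow> surv G y \<le> surv G x"
  using P.cdf_nondecreasing[of x y] by (simp add: surv_def G_eq)

lemma surv_0: "surv G 0 = 1"
proof -
  have "emeasure P {..0} = (\<integral>\<^sup>+y\<in>{..0}. ennreal (g y) \<partial>lborel)"
    by (simp add: emeasure_density)
  also have "\<dots> = (\<integral>\<^sup>+y. 0 \<partial>(lborel :: real measure))"
    by (rule nn_integral_cong_AE, use AE_lborel_singleton[of "0::real"] in eventually_elim)
      (auto simp: indicator_def g_negative)
  finally show ?thesis by (simp add: surv_def G_eq cdf_def measure_def)
qed

lemma nn_integral_g_Ioc:
  assumes "x \<le> y"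
  shows "(\<integral>\<^sup>+u\<in>{x<..y}. ennreal (g u) \<partial>lborel) = ennreal (surv G x - surv G y)"
proof -
  have "(\<integral>\<^sup>+u\<in>{x<..y}. ennreal (g u) \<partial>lborel) = emeasure P {x<..y}"
    by (simp add: emeasure_density)
  also have "\<dots> = ennreal (surv G x - surv G y)"
    using P.emeasure_Ioc[OF assms] by (simp add: surv_def G_eq)
  finally show ?thesis .
qed

text \<open>Continuity of \<open>surv G\<close> is used here: if it is positive at \<open>x\<close>,
  it is still positive slightly beyond \<open>x\<close>, so the infimum \<open>right_end G\<close>
  is strictly larger than \<open>x\<close>. Later arguments about ages can work with positivity of
  survival.\<close>

lemma mem_ages_iff: "x \<in> ages G \<longleftrightarrow> 0 \<le> x \<and> 0 < surv G x"
proof (cases "0 \<le> x")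
  case True
  show ?thesis
  proof
    assume x: "x \<in> ages G"
    have "surv G x \<noteq> 0"
    proof
      assume "surv G x = 0"
      then have "right_end G \<le> ereal x"
        unfolding right_end_def using True by (intro INF_lower) (auto simp: surv_def)
      with x show False by (auto simp: ages_def)
    qed
    then show "0 \<le> x \<and> 0 < surv G x" using True surv_nonneg[of x] by auto
  next
    assume x: "0 \<le> x \<and> 0 < surv G x"
    have "isCont (surv G) x"
      using continuous_surv[of UNIV] by (simp add: continuous_on_eq_continuous_at)
    then obtain d where d: "d > 0" "\<And>y. \<bar>y - x\<bar> < d \<Longrightarrow> \<bar>surv G y - surv G x\<bar> < surv G x"
      using x unfolding continuous_at_eps_delta dist_real_def by meson
    from d(2)[of "x + d / 2"] d(1) have pos: "0 < surv G (x + d / 2)" by auto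
    have "ereal (x + d / 2) \<le> right_end G"
      unfolding right_end_def
    proof (rule INF_greatest)
      fix y assume y: "y \<in> {x. 0 \<le> x \<and> G x = 1}"
      then have "surv G y = 0" by (simp add: surv_def)
      then have "x + d / 2 \<le> y" using surv_antimono[of y "x + d / 2"] pos by fastforce
      then show "ereal (x + d / 2) \<le> ereal y" by simp
    qed
    moreover have "ereal x < ereal (x + d / 2)" using d(1) by simp
    ultimately have "ereal x < right_end G" by (rule less_le_trans[rotated])
    then show "x \<in> ages G" using x by (simp add: ages_def)
  qed
qed (auto simp: ages_def)

lemma ages_eq: "ages G = {0..} \<inter> {x. 0 < surv G x}"
  by (auto simp: mem_ages_iff)

lemma ages_measurable [measurable]: "ages G \<in> sets borel"
  unfolding ages_eq by measurable

lemma zero_in_ages: "0 \<in> ages G"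
  by (simp add: mem_ages_iff surv_0)

lemma surv_eq_0: "0 \<le> x \<Longrightarrow> x \<notin> ages G \<Longrightarrow> surv G x = 0"
  using surv_nonneg[of x] by (auto simp: mem_ages_iff)

lemma ages_down: "y \<in> ages G \<Longrightarrow> 0 \<le> x \<Longrightarrow> x \<le> y \<Longrightarrow> x \<in> ages G"
  using surv_antimono[of x y] by (auto simp: mem_ages_iff)

lemma hazard_nonneg: "0 \<le> hazard G g x"
  by (simp add: hazard_def g_nonneg surv_nonneg)

lemma hazard_measurable [measurable]: "hazard G g \<in> borel_measurable borel"
  unfolding hazard_def[abs_def] by measurable

text \<open>If survival reaches 0, its zero set is closed and contains its infimum, so the law has
  no mass beyond that point. Every nonnegative number that is not an age is at least this infimum,
  and the single endpoint is null.\<close>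

lemma AE_g_zero: "AE u in lborel. 0 \<le> u \<longrightarrow> u \<notin> ages G \<longrightarrow> g u = 0"
proof (cases "{0..} \<subseteq> ages G")
  case True
  then show ?thesis by (intro AE_I2) auto
next
  case False
  define S where "S = {x. 0 \<le> x \<and> surv G x = 0}"
  have ne: "S \<noteq> {}" using False surv_eq_0 by (auto simp: S_def)
  have bdd: "bdd_below S" by (auto simp: S_def intro!: bdd_belowI[of _ 0])
  have "S = {0..} \<inter> surv G -` {0}" by (auto simp: S_def)
  then have "closed S"
    using continuous_closed_preimage[OF continuous_surv[of "{0..}"], of "{0}"] by simp
  then have m: "Inf S \<in> S" by (rule closed_contains_Inf[OF ne bdd])
  have "measure P {Inf S<..} = 0"
  proof -
    have "measure P (- {..Inf S}) = 1 - measure P {..Inf S}"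
      using P.prob_compl[of "{..Inf S}"] by (simp add: Compl_eq_Diff_UNIV)
    then show ?thesis using m by (simp add: S_def surv_def G_eq cdf_def)
  qed
  then have "emeasure P {Inf S<..} = 0" by (simp add: P.emeasure_eq_measure)
  then have "(\<integral>\<^sup>+u. ennreal (g u) * indicator {Inf S<..} u \<partial>lborel) = 0"
    by (simp add: emeasure_density)
  then have "AE u in lborel. ennreal (g u) * indicator {Inf S<..} u = 0"
    by (subst (asm) nn_integral_0_iff_AE) auto
  with AE_lborel_singleton[of "Inf S"] show ?thesis
  proof eventually_elim
    case (elim u)
    show ?case
    proof (intro impI)
      assume u: "0 \<le> u" "u \<notin> ages G"
      then have "u \<in> S" using surv_eq_0 by (auto simp: S_def)
      then have "Inf S \<le> u" by (rule cInf_lower[OF _ bdd])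
      with elim have "ennreal (g u) = 0" by (auto simp: indicator_def)
      then show "g u = 0" using g_nonneg[of u] by (simp add: ennreal_eq_0_iff)
    qed
  qed
qed

text \<open>On the ages, \<open>surv \<sdot> hazard\<close> is the density; off the ages the hazard is the junk value \<open>g / 0 = 0\<close>.\<close>

lemma surv_mult_hazard: "x \<in> ages G \<Longrightarrow> surv G x * hazard G g x = g x"
  by (auto simp: mem_ages_iff hazard_def)

lemma nn_integral_surv_hazard:
  assumes "0 \<le> a" "a \<le> b"
  shows "(\<integral>\<^sup>+s. ennreal (surv G s * hazard G g s) * indicator (ages G) s * indicator {a..b} s \<partial>lborel)
    = ennreal (surv G a - surv G b)"
proof -
  have "(\<integral>\<^sup>+s. ennreal (surv G s * hazard G g s) * indicator (ages G) s * indicator {a..b} s \<partial>lborel)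
    = (\<integral>\<^sup>+s\<in>{a<..b}. ennreal (g s) \<partial>lborel)"
    by (rule nn_integral_cong_AE, use AE_g_zero AE_lborel_singleton[of a] in eventually_elim)
      (use assms in \<open>auto simp: indicator_def surv_mult_hazard\<close>)
  then show ?thesis by (simp add: nn_integral_g_Ioc[OF assms(2)])
qed

text \<open>Ages up to \<open>t\<close> belong to arrivals after time 0, larger ones to the initial population.\<close>

definition aged :: "(real \<Rightarrow> real) \<Rightarrow> (real \<Rightarrow> real) \<Rightarrow> real \<Rightarrow> real \<Rightarrow> real" where
  "aged l f0 t x =
     (if x \<le> t then l (t - x) * surv G x else f0 (x - t) * (surv G x / surv G (x - t)))"

text \<open>The pairs \<open>(t,x)\<close> and \<open>(t+u,x+u)\<close> have the same difference, so
  they fall in the same case of \<open>aged\<close>, and the survival factors telescope.\<close>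

lemma aging_aged: "aging G (aged l f0)"
  unfolding aging_def
proof (intro allI impI)
  fix t u x :: real assume *: "0 \<le> t \<and> 0 < u \<and> x \<in> ages G"
  then have "surv G x \<noteq> 0" by (simp add: mem_ages_iff)
  then show "aged l f0 (t + u) (x + u) = aged l f0 t x * (surv G (x + u) / surv G x)"
    by (simp add: aged_def)
qed

lemma aged_eq_0: "0 \<le> x \<Longrightarrow> x \<notin> ages G \<Longrightarrow> aged l f0 t x = 0"
  by (simp add: aged_def surv_eq_0)

lemma aged_0_pos: "0 < x \<Longrightarrow> x \<in> ages G \<Longrightarrow> aged l f0 0 x = f0 x"
  by (simp add: aged_def mem_ages_iff)

lemma aged_0_right: "0 \<le> t \<Longrightarrow> aged l f0 t 0 = l t"
  by (simp add: aged_def surv_0)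

end

section \<open>Transport and mass balance for a given inflow\<close>

locale aged_population = lifetime +
  fixes l f0 :: "real \<Rightarrow> real"
  assumes l_measurable [measurable]: "l \<in> borel_measurable borel"
    and l_nonneg: "0 \<le> l s"
    and l_integrable: "set_integrable lborel {0..t} l"
    and f0_measurable [measurable]: "f0 \<in> borel_measurable borel"
    and f0_nonneg: "0 \<le> x \<Longrightarrow> 0 \<le> f0 x"
    and f0_integrable: "set_integrable lborel {0..} f0"
begin

abbreviation "f \<equiv> aged l f0"

lemma aged_measurable_pair: "(\<lambda>(t, x). f t x) \<in> borel_measurable (borel \<Otimes>\<^sub>M borel)"
  unfolding aged_def by measurable

lemma aged_measurable [measurable]: "f t \<in> borel_measurable borel"
  unfolding aged_def[abs_def] by measurable

lemma aged_nonneg: "0 \<le> t \<Longrightarrow> 0 \<le> x \<Longrightarrow> 0 \<le> f t x"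
  by (auto simp: aged_def l_nonneg surv_nonneg intro!: mult_nonneg_nonneg f0_nonneg divide_nonneg_nonneg)

text \<open>Each person is relabelled by a quantity that does not change with time: ages up to
  \<open>t\<close> by the arrival time \<open>s = t - x\<close>, larger ones by the initial age
  \<open>y = x - t\<close>.\<close>

lemma nn_integral_aged:
  assumes t: "0 \<le> t" and [measurable]: "h \<in> borel_measurable borel"
  shows "(\<integral>\<^sup>+x\<in>{0..}. ennreal (f t x) * h x \<partial>lborel) =
    (\<integral>\<^sup>+y\<in>ages G. ennreal (f0 y * (surv G (y + t) / surv G y)) * h (y + t) \<partial>lborel) +
    (\<integral>\<^sup>+s\<in>{0..t}. ennreal (l s * surv G (t - s)) * h (t - s) \<partial>lborel)"
proof -
  have "(\<integral>\<^sup>+x\<in>{0..}. ennreal (f t x) * h x \<partial>lborel) =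
      (\<integral>\<^sup>+x. ennreal (f t x) * h x * indicator {t<..} x + ennreal (f t x) * h x * indicator {0..t} x \<partial>lborel)"
    by (intro nn_integral_cong) (use t in \<open>auto simp: indicator_def\<close>)
  also have "\<dots> = (\<integral>\<^sup>+x\<in>{t<..}. ennreal (f t x) * h x \<partial>lborel) + (\<integral>\<^sup>+x\<in>{0..t}. ennreal (f t x) * h x \<partial>lborel)"
    by (rule nn_integral_add) measurable
  also have "(\<integral>\<^sup>+x\<in>{0..t}. ennreal (f t x) * h x \<partial>lborel)
      = (\<integral>\<^sup>+s. ennreal (f t (t + (-1) * s)) * h (t + (-1) * s) * indicator {0..t} (t + (-1) * s) \<partial>lborel)"
    by (subst nn_integral_real_affine[where c="-1" and t=t]) auto
  also have "\<dots> = (\<integral>\<^sup>+s\<in>{0..t}. ennreal (l s * surv G (t - s)) * h (t - s) \<partial>lborel)"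
    by (intro nn_integral_cong) (auto simp: indicator_def aged_def)
  also have "(\<integral>\<^sup>+x\<in>{t<..}. ennreal (f t x) * h x \<partial>lborel)
      = (\<integral>\<^sup>+y. ennreal (f t (t + 1 * y)) * h (t + 1 * y) * indicator {t<..} (t + 1 * y) \<partial>lborel)"
    by (subst nn_integral_real_affine[where c="1" and t=t]) auto
  \<comment> \<open>Age 0 lies in \<open>ages G\<close> but is cut off on the left side, hence the
    exclusion of one point. For positive \<open>y\<close> outside the ages the quotient by
    \<open>surv G y = 0\<close> is 0, so restricting to \<open>ages G\<close> loses nothing.\<close>
  also have "\<dots> = (\<integral>\<^sup>+y\<in>ages G. ennreal (f0 y * (surv G (y + t) / surv G y)) * h (y + t) \<partial>lborel)"
  proof (rule nn_integral_cong_AE, use AE_lborel_singleton[of "0::real"] in eventually_elim)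
    fix y :: real assume "y \<noteq> 0"
    then show "ennreal (f t (t + 1 * y)) * h (t + 1 * y) * indicator {t<..} (t + 1 * y)
        = ennreal (f0 y * (surv G (y + t) / surv G y)) * h (y + t) * indicator (ages G) y"
      using surv_eq_0[of y] by (cases "y \<in> ages G") (auto simp: indicator_def aged_def ages_def add.commute)
  qed
  finally show ?thesis .
qed

lemma nn_integral_f0_finite: "(\<integral>\<^sup>+y\<in>ages G. ennreal (f0 y) \<partial>lborel) < \<infinity>"
proof -
  have "(\<integral>\<^sup>+y\<in>ages G. ennreal (f0 y) \<partial>lborel) \<le> (\<integral>\<^sup>+y\<in>{0..}. ennreal (f0 y) \<partial>lborel)"
    by (intro nn_integral_mono) (auto simp: indicator_def ages_def)
  also have "\<dots> < \<infinity>"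
    by (subst nn_integral_set_eq_integral[OF f0_integrable f0_nonneg]) auto
  finally show ?thesis .
qed

lemma nn_integral_l: "(\<integral>\<^sup>+s\<in>{0..t}. ennreal (l s) \<partial>lborel) = ennreal (LINT s:{0..t}|lborel. l s)"
  by (rule nn_integral_set_eq_integral[OF l_integrable l_nonneg])

lemma surv_ratio_le_1: "0 \<le> t \<Longrightarrow> surv G (y + t) / surv G y \<le> 1"
  using surv_antimono[of y "y + t"] surv_nonneg[of y] by (cases "surv G y = 0") (auto simp: divide_simps)

lemma nn_integral_old_finite:
  assumes t: "0 \<le> t" and h: "\<And>x. h x \<le> 1"
  shows "(\<integral>\<^sup>+y\<in>ages G. ennreal (f0 y * (surv G (y + t) / surv G y)) * h (y + t) \<partial>lborel) < \<infinity>"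
proof -
  have "(\<integral>\<^sup>+y\<in>ages G. ennreal (f0 y * (surv G (y + t) / surv G y)) * h (y + t) \<partial>lborel)
      \<le> (\<integral>\<^sup>+y\<in>ages G. ennreal (f0 y) \<partial>lborel)"
  proof (intro nn_integral_mono)
    fix y
    show "ennreal (f0 y * (surv G (y + t) / surv G y)) * h (y + t) * indicator (ages G) y
      \<le> ennreal (f0 y) * indicator (ages G) y"
    proof (cases "y \<in> ages G")
      case True
      then have "f0 y * (surv G (y + t) / surv G y) \<le> f0 y * 1"
        by (intro mult_left_mono surv_ratio_le_1 t f0_nonneg) (auto simp: ages_def)
      then have "ennreal (f0 y * (surv G (y + t) / surv G y)) * h (y + t) \<le> ennreal (f0 y) * 1"
        by (intro mult_mono h ennreal_leI) auto
      then show ?thesis using True by simp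
    qed simp
  qed
  also note nn_integral_f0_finite
  finally show ?thesis .
qed

lemma nn_integral_new_finite:
  assumes h: "\<And>x. h x \<le> 1"
  shows "(\<integral>\<^sup>+s\<in>{0..t}. ennreal (l s * surv G (t - s)) * h (t - s) \<partial>lborel) < \<infinity>"
proof -
  have "(\<integral>\<^sup>+s\<in>{0..t}. ennreal (l s * surv G (t - s)) * h (t - s) \<partial>lborel)
      \<le> (\<integral>\<^sup>+s\<in>{0..t}. ennreal (l s) \<partial>lborel)"
  proof (intro nn_integral_mono mult_right_mono)
    fix s
    have "l s * surv G (t - s) \<le> l s * 1" by (intro mult_left_mono surv_le_1 l_nonneg)
    then show "ennreal (l s * surv G (t - s)) * h (t - s) \<le> ennreal (l s)"
      using mult_mono[OF ennreal_leI h, of "l s * surv G (t - s)" "l s" "t - s"] by simp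
  qed simp
  also have "\<dots> < \<infinity>" by (simp add: nn_integral_l)
  finally show ?thesis .
qed

lemma aged_integrable:
  assumes t: "0 \<le> t"
  shows "set_integrable lborel {0..} (f t)"
  unfolding set_integrable_def
proof (rule integrableI_nonneg)
  show "AE x in lborel. 0 \<le> indicator {0..} x *\<^sub>R f t x"
    using aged_nonneg[OF t] by (auto simp: indicator_def)
  have "(\<integral>\<^sup>+ x. ennreal (indicator {0..} x *\<^sub>R f t x) \<partial>lborel) = (\<integral>\<^sup>+x\<in>{0..}. ennreal (f t x) * 1 \<partial>lborel)"
    by (intro nn_integral_cong) (auto simp: indicator_def)
  also have "\<dots> < \<infinity>"
    using nn_integral_old_finite[OF t, of "\<lambda>_. 1"] nn_integral_new_finite[of "\<lambda>_. 1" t]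
    by (subst nn_integral_aged[OF t]) auto
  finally show "(\<integral>\<^sup>+ x. ennreal (indicator {0..} x *\<^sub>R f t x) \<partial>lborel) < \<infinity>" .
qed measurable

text \<open>The right side has the shape of the equations of the measure-valued model. With
  \<open>\<psi>\<close> in \<open>[0,1]\<close> all terms are nonnegative and finite, so
  \<open>nn_integral_aged\<close> can be read back in the reals.\<close>

lemma integral_aged:
  assumes t: "0 \<le> t" and [measurable]: "\<psi> \<in> borel_measurable borel"
    and \<psi>: "\<And>x. 0 \<le> \<psi> x \<and> \<psi> x \<le> 1"
  shows "(LINT x:{0..}|lborel. \<psi> x * f t x) =
    (LINT y:ages G|age_law f0. \<psi> (y + t) * (surv G (y + t) / surv G y)) +
    (LINT s:{0..t}|lborel. \<psi> (t - s) * surv G (t - s) * l s)"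
proof -
  have "(LINT x:{0..}|lborel. \<psi> x * f t x)
      = enn2real (\<integral>\<^sup>+x. ennreal (indicator {0..} x *\<^sub>R (\<psi> x * f t x)) \<partial>lborel)"
    unfolding set_lebesgue_integral_def
    by (rule integral_eq_nn_integral) (use \<psi> aged_nonneg[OF t] in \<open>auto simp: indicator_def\<close>)
  also have "(\<integral>\<^sup>+x. ennreal (indicator {0..} x *\<^sub>R (\<psi> x * f t x)) \<partial>lborel)
      = (\<integral>\<^sup>+x\<in>{0..}. ennreal (f t x) * ennreal (\<psi> x) \<partial>lborel)"
    using \<psi> aged_nonneg[OF t]
    by (intro nn_integral_cong) (auto simp: indicator_def ennreal_mult'' mult.commute)
  also have "\<dots> = (\<integral>\<^sup>+y\<in>ages G. ennreal (f0 y * (surv G (y + t) / surv G y)) * ennreal (\<psi> (y + t)) \<partial>lborel) +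
    (\<integral>\<^sup>+s\<in>{0..t}. ennreal (l s * surv G (t - s)) * ennreal (\<psi> (t - s)) \<partial>lborel)"
    by (rule nn_integral_aged[OF t]) measurable
  also have "enn2real \<dots> = enn2real (\<integral>\<^sup>+y\<in>ages G. ennreal (f0 y * (surv G (y + t) / surv G y)) * ennreal (\<psi> (y + t)) \<partial>lborel) +
    enn2real (\<integral>\<^sup>+s\<in>{0..t}. ennreal (l s * surv G (t - s)) * ennreal (\<psi> (t - s)) \<partial>lborel)"
    using \<psi> by (intro enn2real_plus nn_integral_old_finite[OF t, unfolded infinity_ennreal_def]
      nn_integral_new_finite[unfolded infinity_ennreal_def]) auto
  also have "(\<integral>\<^sup>+y\<in>ages G. ennreal (f0 y * (surv G (y + t) / surv G y)) * ennreal (\<psi> (y + t)) \<partial>lborel)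
     = (\<integral>\<^sup>+y. ennreal ((indicator {0..} y * f0 y) *\<^sub>R (indicator (ages G) y *\<^sub>R (\<psi> (y + t) * (surv G (y + t) / surv G y)))) \<partial>lborel)"
  proof (intro nn_integral_cong)
    fix y
    have "ennreal (f0 y * (surv G (y + t) / surv G y)) * ennreal (\<psi> (y + t))
      = ennreal (f0 y * (\<psi> (y + t) * (surv G (y + t) / surv G y)))"
      using \<psi> by (subst ennreal_mult''[symmetric]) (auto simp: ac_simps)
    then show "ennreal (f0 y * (surv G (y + t) / surv G y)) * ennreal (\<psi> (y + t)) * indicator (ages G) y
      = ennreal ((indicator {0..} y * f0 y) *\<^sub>R (indicator (ages G) y *\<^sub>R (\<psi> (y + t) * (surv G (y + t) / surv G y))))"
      by (auto simp: indicator_def ages_def)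
  qed
  also have "enn2real \<dots> = (LINT y|lborel. (indicator {0..} y * f0 y) *\<^sub>R (indicator (ages G) y *\<^sub>R (\<psi> (y + t) * (surv G (y + t) / surv G y))))"
    by (rule integral_eq_nn_integral[symmetric])
      (use \<psi> f0_nonneg surv_nonneg in \<open>auto simp: indicator_def\<close>)
  also have "\<dots> = (LINT y:ages G|age_law f0. \<psi> (y + t) * (surv G (y + t) / surv G y))"
    unfolding set_lebesgue_integral_def age_law_alt
    by (rule integral_density[symmetric]) (auto simp: indicator_def f0_nonneg)
  also have "(\<integral>\<^sup>+s\<in>{0..t}. ennreal (l s * surv G (t - s)) * ennreal (\<psi> (t - s)) \<partial>lborel)
     = (\<integral>\<^sup>+s. ennreal (indicator {0..t} s *\<^sub>R (\<psi> (t - s) * surv G (t - s) * l s)) \<partial>lborel)"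
  proof (intro nn_integral_cong)
    fix s
    have "ennreal (l s * surv G (t - s)) * ennreal (\<psi> (t - s)) = ennreal (\<psi> (t - s) * surv G (t - s) * l s)"
      using \<psi> by (subst ennreal_mult''[symmetric]) (auto simp: ac_simps)
    then show "ennreal (l s * surv G (t - s)) * ennreal (\<psi> (t - s)) * indicator {0..t} s
      = ennreal (indicator {0..t} s *\<^sub>R (\<psi> (t - s) * surv G (t - s) * l s))"
      by (auto simp: indicator_def)
  qed
  also have "enn2real \<dots> = (LINT s:{0..t}|lborel. \<psi> (t - s) * surv G (t - s) * l s)"
    unfolding set_lebesgue_integral_def
    by (rule integral_eq_nn_integral[symmetric])
      (use \<psi> l_nonneg surv_nonneg in \<open>auto simp: indicator_def\<close>)
  finally show ?thesis .
qed

lemma nn_integral_aged_mass: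
  "0 \<le> t \<Longrightarrow> (\<integral>\<^sup>+x\<in>{0..}. ennreal (f t x) \<partial>lborel) = ennreal (mass (f t))"
  unfolding mass_def by (rule nn_integral_set_eq_integral[OF aged_integrable aged_nonneg]) auto

text \<open>On the ages this is the lifetime density \<open>g\<close>. It is written as a product
  because the hazard flow of \<open>aged\<close> pairs a survival factor with the hazard.\<close>

definition exit :: "real \<Rightarrow> ennreal" where
  "exit s = ennreal (surv G s * hazard G g s) * indicator (ages G) s"

lemma exit_measurable [measurable]: "exit \<in> borel_measurable borel"
  unfolding exit_def[abs_def] by measurable

lemma nn_integral_exit_shift:
  assumes "0 \<le> y" "0 \<le> t"
  shows "(\<integral>\<^sup>+s. exit (y + s) * indicator {0..t} s \<partial>lborel) = ennreal (surv G y - surv G (y + t))"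
proof -
  have "ennreal (surv G y - surv G (y + t)) = (\<integral>\<^sup>+u. exit u * indicator {y..y + t} u \<partial>lborel)"
    unfolding exit_def using nn_integral_surv_hazard[of y "y + t"] assms by simp
  also have "\<dots> = (\<integral>\<^sup>+s. exit (y + 1 * s) * indicator {y..y + t} (y + 1 * s) \<partial>lborel)"
    by (subst nn_integral_real_affine[where c=1 and t=y]) auto
  also have "\<dots> = (\<integral>\<^sup>+s. exit (y + s) * indicator {0..t} s \<partial>lborel)"
    by (intro nn_integral_cong) (auto simp: indicator_def)
  finally show ?thesis by simp
qed

text \<open>The departures are sorted by cohort: initial age \<open>y\<close> contributes at rate
  \<open>exit (y + s) / surv G y\<close> per unit of mass, arrival time \<open>u\<close> at rate
  \<open>exit (s - u)\<close>.\<close>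

lemma hazard_flow_aged:
  assumes "0 \<le> s"
  shows "hazard_flow G g f s =
    (\<integral>\<^sup>+y. ennreal (f0 y / surv G y) * exit (y + s) * indicator (ages G) y \<partial>lborel) +
    (\<integral>\<^sup>+u. ennreal (l u) * exit (s - u) * indicator {0..s} u \<partial>lborel)"
proof -
  let ?h = "\<lambda>x. ennreal (hazard G g x) * indicator (ages G) x"
  have "hazard_flow G g f s = (\<integral>\<^sup>+x\<in>{0..}. ennreal (f s x) * ?h x \<partial>lborel)"
    unfolding hazard_flow_def
    by (intro nn_integral_cong)
      (auto simp: indicator_def ages_def ennreal_mult hazard_nonneg aged_nonneg[OF assms])
  also have "\<dots> = (\<integral>\<^sup>+y\<in>ages G. ennreal (f0 y * (surv G (y + s) / surv G y)) * ?h (y + s) \<partial>lborel) +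
    (\<integral>\<^sup>+u\<in>{0..s}. ennreal (l u * surv G (s - u)) * ?h (s - u) \<partial>lborel)"
    by (rule nn_integral_aged[OF assms]) measurable
  also have "(\<integral>\<^sup>+y\<in>ages G. ennreal (f0 y * (surv G (y + s) / surv G y)) * ?h (y + s) \<partial>lborel)
    = (\<integral>\<^sup>+y. ennreal (f0 y / surv G y) * exit (y + s) * indicator (ages G) y \<partial>lborel)"
  proof (rule nn_integral_cong)
    fix y
    show "ennreal (f0 y * (surv G (y + s) / surv G y)) * ?h (y + s) * indicator (ages G) y
      = ennreal (f0 y / surv G y) * exit (y + s) * indicator (ages G) y"
    proof (cases "y \<in> ages G")
      case True
      then have "ennreal (f0 y * (surv G (y + s) / surv G y)) = ennreal (f0 y / surv G y) * ennreal (surv G (y + s))"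
        using f0_nonneg[of y] surv_nonneg by (subst ennreal_mult[symmetric]) (auto simp: ages_def)
      then show ?thesis
        by (simp add: exit_def ennreal_mult surv_nonneg hazard_nonneg mult.assoc)
    qed simp
  qed
  also have "(\<integral>\<^sup>+u\<in>{0..s}. ennreal (l u * surv G (s - u)) * ?h (s - u) \<partial>lborel)
    = (\<integral>\<^sup>+u. ennreal (l u) * exit (s - u) * indicator {0..s} u \<partial>lborel)"
    by (rule nn_integral_cong)
      (simp add: exit_def ennreal_mult surv_nonneg hazard_nonneg l_nonneg mult.assoc)
  finally show ?thesis .
qed

text \<open>After exchanging the integrals, the inner one is the total exit of a single cohort up to
  time \<open>t\<close>, which is a drop of the survival function.\<close>

lemma nn_integral_hazard_flow_aged:
  assumes t: "0 \<le> t"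
  shows "(\<integral>\<^sup>+s\<in>{0..t}. hazard_flow G g f s \<partial>lborel) =
    (\<integral>\<^sup>+y\<in>ages G. ennreal (f0 y / surv G y) * ennreal (surv G y - surv G (y + t)) \<partial>lborel) +
    (\<integral>\<^sup>+u\<in>{0..t}. ennreal (l u) * ennreal (1 - surv G (t - u)) \<partial>lborel)"
proof -
  have "(\<integral>\<^sup>+s\<in>{0..t}. hazard_flow G g f s \<partial>lborel) =
    (\<integral>\<^sup>+s. (\<integral>\<^sup>+y. ennreal (f0 y / surv G y) * exit (y + s) * indicator (ages G) y * indicator {0..t} s \<partial>lborel) +
    (\<integral>\<^sup>+u. ennreal (l u) * exit (s - u) * indicator {0..s} u * indicator {0..t} s \<partial>lborel) \<partial>lborel)"
    by (intro nn_integral_cong) (auto simp: indicator_def hazard_flow_aged)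
  also have "\<dots> = (\<integral>\<^sup>+s. (\<integral>\<^sup>+y. ennreal (f0 y / surv G y) * exit (y + s) * indicator (ages G) y * indicator {0..t} s \<partial>lborel) \<partial>lborel) +
    (\<integral>\<^sup>+s. (\<integral>\<^sup>+u. ennreal (l u) * exit (s - u) * indicator {0..s} u * indicator {0..t} s \<partial>lborel) \<partial>lborel)"
    by (rule nn_integral_add) (simp_all add: indicator_def[of "{0.._}"])
  also have "(\<integral>\<^sup>+s. (\<integral>\<^sup>+y. ennreal (f0 y / surv G y) * exit (y + s) * indicator (ages G) y * indicator {0..t} s \<partial>lborel) \<partial>lborel)
    = (\<integral>\<^sup>+y. (\<integral>\<^sup>+s. ennreal (f0 y / surv G y) * exit (y + s) * indicator (ages G) y * indicator {0..t} s \<partial>lborel) \<partial>lborel)"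
    by (rule lborel_pair.Fubini') simp
  also have "\<dots> = (\<integral>\<^sup>+y\<in>ages G. ennreal (f0 y / surv G y) * ennreal (surv G y - surv G (y + t)) \<partial>lborel)"
  proof (rule nn_integral_cong)
    fix y
    have "(\<integral>\<^sup>+s. ennreal (f0 y / surv G y) * exit (y + s) * indicator (ages G) y * indicator {0..t} s \<partial>lborel)
      = (\<integral>\<^sup>+s. (ennreal (f0 y / surv G y) * indicator (ages G) y) * (exit (y + s) * indicator {0..t} s) \<partial>lborel)"
      by (intro nn_integral_cong) (simp add: ac_simps)
    also have "\<dots> = (ennreal (f0 y / surv G y) * indicator (ages G) y) * (\<integral>\<^sup>+s. exit (y + s) * indicator {0..t} s \<partial>lborel)"
      by (rule nn_integral_cmult) measurable
    finally show "(\<integral>\<^sup>+s. ennreal (f0 y / surv G y) * exit (y + s) * indicator (ages G) y * indicator {0..t} s \<partial>lborel)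
      = ennreal (f0 y / surv G y) * ennreal (surv G y - surv G (y + t)) * indicator (ages G) y"
      using nn_integral_exit_shift[of y t] t by (cases "y \<in> ages G") (auto simp: ages_def)
  qed
  also have "(\<integral>\<^sup>+s. (\<integral>\<^sup>+u. ennreal (l u) * exit (s - u) * indicator {0..s} u * indicator {0..t} s \<partial>lborel) \<partial>lborel)
    = (\<integral>\<^sup>+u. (\<integral>\<^sup>+s. ennreal (l u) * exit (s - u) * indicator {0..s} u * indicator {0..t} s \<partial>lborel) \<partial>lborel)"
    by (rule lborel_pair.Fubini') (simp add: indicator_def[of "{0.._}"])
  also have "\<dots> = (\<integral>\<^sup>+u\<in>{0..t}. ennreal (l u) * ennreal (1 - surv G (t - u)) \<partial>lborel)"
  proof (rule nn_integral_cong)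
    fix u
    \<comment> \<open>The triangle \<open>0 \<le> u \<le> s \<le> t\<close> is now sliced at fixed
      \<open>u\<close>, so that \<open>s\<close> runs over \<open>[u,t]\<close>.\<close>
    have "(\<integral>\<^sup>+s. ennreal (l u) * exit (s - u) * indicator {0..s} u * indicator {0..t} s \<partial>lborel)
      = (\<integral>\<^sup>+s. (ennreal (l u) * indicator {0..t} u) * (exit (s - u) * indicator {u..t} s) \<partial>lborel)"
      by (intro nn_integral_cong) (auto simp: indicator_def)
    also have "\<dots> = (ennreal (l u) * indicator {0..t} u) * (\<integral>\<^sup>+s. exit (s - u) * indicator {u..t} s \<partial>lborel)"
      by (rule nn_integral_cmult) measurable
    also have "(\<integral>\<^sup>+s. exit (s - u) * indicator {u..t} s \<partial>lborel)
        = (\<integral>\<^sup>+s. exit (u + 1 * s - u) * indicator {u..t} (u + 1 * s) \<partial>lborel)"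
      by (subst nn_integral_real_affine[where c=1 and t=u]) auto
    also have "\<dots> = (\<integral>\<^sup>+s. exit (0 + s) * indicator {0..t - u} s \<partial>lborel)"
      by (intro nn_integral_cong) (auto simp: indicator_def)
    finally show "(\<integral>\<^sup>+s. ennreal (l u) * exit (s - u) * indicator {0..s} u * indicator {0..t} s \<partial>lborel)
      = ennreal (l u) * ennreal (1 - surv G (t - u)) * indicator {0..t} u"
      using nn_integral_exit_shift[of 0 "t - u"] by (cases "u \<in> {0..t}") (auto simp: surv_0)
  qed
  finally show ?thesis .
qed

text \<open>Within each cohort the surviving and the departed fractions add up to 1. The identity is
  kept in \<open>ennreal\<close>, where it also proves that the accumulated hazard flow is
  finite.\<close>

lemma aged_mass_balance:
  assumes t: "0 \<le> t"
  shows "ennreal (mass (f t)) + (\<integral>\<^sup>+s\<in>{0..t}. hazard_flow G g f s \<partial>lborel)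
    = (\<integral>\<^sup>+y\<in>ages G. ennreal (f0 y) \<partial>lborel) + ennreal (LINT s:{0..t}|lborel. l s)"
proof -
  have "ennreal (mass (f t)) = (\<integral>\<^sup>+x\<in>{0..}. ennreal (f t x) * 1 \<partial>lborel)"
    using nn_integral_aged_mass[OF t] by simp
  also have "\<dots> = (\<integral>\<^sup>+y\<in>ages G. ennreal (f0 y * (surv G (y + t) / surv G y)) \<partial>lborel) +
    (\<integral>\<^sup>+s\<in>{0..t}. ennreal (l s * surv G (t - s)) \<partial>lborel)"
    by (subst nn_integral_aged[OF t]) simp_all
  finally have m: "ennreal (mass (f t)) = \<dots>" .
  have "ennreal (mass (f t)) + (\<integral>\<^sup>+s\<in>{0..t}. hazard_flow G g f s \<partial>lborel) =
    ((\<integral>\<^sup>+y\<in>ages G. ennreal (f0 y * (surv G (y + t) / surv G y)) \<partial>lborel) +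
     (\<integral>\<^sup>+y\<in>ages G. ennreal (f0 y / surv G y) * ennreal (surv G y - surv G (y + t)) \<partial>lborel)) +
    ((\<integral>\<^sup>+s\<in>{0..t}. ennreal (l s * surv G (t - s)) \<partial>lborel) +
     (\<integral>\<^sup>+u\<in>{0..t}. ennreal (l u) * ennreal (1 - surv G (t - u)) \<partial>lborel))"
    unfolding m nn_integral_hazard_flow_aged[OF t] by (simp only: add.assoc add.left_commute)
  also have "((\<integral>\<^sup>+y\<in>ages G. ennreal (f0 y * (surv G (y + t) / surv G y)) \<partial>lborel) +
     (\<integral>\<^sup>+y\<in>ages G. ennreal (f0 y / surv G y) * ennreal (surv G y - surv G (y + t)) \<partial>lborel))
    = (\<integral>\<^sup>+y. ennreal (f0 y * (surv G (y + t) / surv G y)) * indicator (ages G) y +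
        ennreal (f0 y / surv G y) * ennreal (surv G y - surv G (y + t)) * indicator (ages G) y \<partial>lborel)"
    by (rule nn_integral_add[symmetric]) measurable
  also have "\<dots> = (\<integral>\<^sup>+y\<in>ages G. ennreal (f0 y) \<partial>lborel)"
  proof (rule nn_integral_cong)
    fix y
    show "ennreal (f0 y * (surv G (y + t) / surv G y)) * indicator (ages G) y +
        ennreal (f0 y / surv G y) * ennreal (surv G y - surv G (y + t)) * indicator (ages G) y
      = ennreal (f0 y) * indicator (ages G) y"
    proof (cases "y \<in> ages G")
      case True
      then have y: "0 \<le> y" "0 < surv G y" by (auto simp: mem_ages_iff)
      have le: "surv G (y + t) \<le> surv G y" using t by (intro surv_antimono) auto
      have "ennreal (f0 y * (surv G (y + t) / surv G y)) + ennreal (f0 y / surv G y) * ennreal (surv G y - surv G (y + t))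
        = ennreal (f0 y * (surv G (y + t) / surv G y) + f0 y / surv G y * (surv G y - surv G (y + t)))"
        using y le f0_nonneg[OF y(1)] surv_nonneg
        by (subst ennreal_mult[symmetric]) (auto simp: ennreal_plus)
      also have "f0 y * (surv G (y + t) / surv G y) + f0 y / surv G y * (surv G y - surv G (y + t)) = f0 y"
        using y by (simp add: field_simps)
      finally show ?thesis using True by simp
    qed simp
  qed
  also have "((\<integral>\<^sup>+s\<in>{0..t}. ennreal (l s * surv G (t - s)) \<partial>lborel) +
     (\<integral>\<^sup>+u\<in>{0..t}. ennreal (l u) * ennreal (1 - surv G (t - u)) \<partial>lborel))
    = (\<integral>\<^sup>+s. ennreal (l s * surv G (t - s)) * indicator {0..t} s +
       ennreal (l s) * ennreal (1 - surv G (t - s)) * indicator {0..t} s \<partial>lborel)"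
    by (rule nn_integral_add[symmetric]) measurable
  also have "\<dots> = (\<integral>\<^sup>+s\<in>{0..t}. ennreal (l s) \<partial>lborel)"
  proof (rule nn_integral_cong)
    fix s
    have "ennreal (l s * surv G (t - s)) + ennreal (l s) * ennreal (1 - surv G (t - s))
      = ennreal (l s * surv G (t - s) + l s * (1 - surv G (t - s)))"
      using l_nonneg[of s] surv_nonneg[of "t - s"] surv_le_1[of "t - s"]
      by (subst ennreal_mult[symmetric]) (auto simp: ennreal_plus)
    also have "l s * surv G (t - s) + l s * (1 - surv G (t - s)) = l s" by (simp add: algebra_simps)
    finally show "ennreal (l s * surv G (t - s)) * indicator {0..t} s +
       ennreal (l s) * ennreal (1 - surv G (t - s)) * indicator {0..t} s = ennreal (l s) * indicator {0..t} s"
      by (simp add: distrib_right[symmetric])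
  qed
  finally show ?thesis by (simp add: nn_integral_l)
qed

lemma locally_integrable_hazard_flow_aged: "locally_integrable_rate (hazard_flow G g f)"
  unfolding locally_integrable_rate_def
proof (intro conjI allI impI)
  have [measurable]: "(\<lambda>z. f (fst z) (snd z)) \<in> borel_measurable (borel \<Otimes>\<^sub>M borel)"
    using aged_measurable_pair by (simp add: case_prod_beta)
  have "hazard_flow G g f \<in> borel_measurable borel"
    unfolding hazard_flow_def[abs_def] by (rule lborel.borel_measurable_nn_integral) simp
  then show "hazard_flow G g f \<in> borel_measurable (restrict_space borel {0..})"
    by (rule measurable_restrict_space1)
  fix t :: real assume t: "0 \<le> t"
  have "(\<integral>\<^sup>+s\<in>{0..t}. hazard_flow G g f s \<partial>lborel)
      \<le> ennreal (mass (f t)) + (\<integral>\<^sup>+s\<in>{0..t}. hazard_flow G g f s \<partial>lborel)" by simp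
  also have "\<dots> < \<infinity>"
    unfolding aged_mass_balance[OF t] using nn_integral_f0_finite by simp
  finally show "(\<integral>\<^sup>+s\<in>{0..t}. hazard_flow G g f s \<partial>lborel) < \<infinity>" .
qed

lemma indefinite_integral_aged_mass:
  "indefinite_integral (\<lambda>t. mass (f t)) (\<lambda>s. l s - enn2real (hazard_flow G g f s))"
proof -
  let ?c = "cumulative (hazard_flow G g f)" and ?L = "\<lambda>t. LINT s:{0..t}|lborel. l s"
  \<comment> \<open>\<open>c0\<close> counts \<open>f0\<close> on the ages only, since density
    values elsewhere are lost in \<open>aged\<close>. It cancels in the increments.\<close>
  obtain c0 where c0: "0 \<le> c0" "(\<integral>\<^sup>+y\<in>ages G. ennreal (f0 y) \<partial>lborel) = ennreal c0"
    using nn_integral_f0_finite by (metis ennreal_cases infinity_ennreal_def less_irrefl)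
  have nn: "0 \<le> mass (f t)" "0 \<le> ?L t" if "0 \<le> t" for t
    unfolding mass_def set_lebesgue_integral_def using that aged_nonneg l_nonneg
    by (auto intro!: integral_nonneg_AE simp: indicator_def)
  have bal: "mass (f t) + ?c t = c0 + ?L t" if t: "0 \<le> t" for t
  proof -
    have "(\<integral>\<^sup>+s\<in>{0..t}. hazard_flow G g f s \<partial>lborel) = ennreal (?c t)"
      using locally_integrable_hazard_flow_aged t
      by (simp add: cumulative_def locally_integrable_rate_def)
    then have "ennreal (mass (f t) + ?c t) = ennreal (c0 + ?L t)"
      using aged_mass_balance[OF t] c0 nn[OF t] by (simp add: ennreal_plus cumulative_def)
    then show ?thesis
      using c0(1) nn[OF t] by (subst (asm) ennreal_inj) (auto simp: cumulative_def)
  qed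
  have L: "indefinite_integral ?L l"
    unfolding indefinite_integral_def
    using l_integrable set_integral_discrete_difference[of "{0}" "{0..0::real}" "{}" lborel l]
    by (auto simp: set_lebesgue_integral_def)
  show ?thesis
    by (rule indefinite_integral_shift[OF indefinite_integral_diff[OF L
      indefinite_integral_cumulative[OF locally_integrable_hazard_flow_aged]]])
      (use bal[of 0] bal in fastforce)
qed

end

section \<open>The fluid model\<close>

lemma has_age_density_age_law:
  assumes "has_age_density M f" "finite_measure M"
  shows "M = age_law f" "set_integrable lborel {0..} f"
proof -
  have f [measurable]: "f \<in> borel_measurable borel" and nn: "\<And>x. 0 \<le> x \<Longrightarrow> 0 \<le> f x"
    and M: "M = density lborel (\<lambda>x. ennreal (f x) * indicator {0..} x)"
    using assms(1) unfolding has_age_density_def by blast+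
  show M': "M = age_law f" by (simp add: M age_law_def)
  have "emeasure M UNIV < \<infinity>"
    using finite_measure.emeasure_finite[OF assms(2), of UNIV] by (simp add: top.not_eq_extremum)
  also have "emeasure M UNIV = (\<integral>\<^sup>+x. ennreal (indicator {0..} x *\<^sub>R f x) \<partial>lborel)"
    unfolding M' age_law_alt by (subst emeasure_density) auto
  finally show "set_integrable lborel {0..} f"
    unfolding set_integrable_def
    by (intro integrableI_nonneg) (auto simp: indicator_def nn)
qed

lemma nn_integral_age_law:
  assumes f: "set_integrable lborel {0..} f" "\<And>x. 0 \<le> x \<Longrightarrow> 0 \<le> f x"
    and [measurable]: "h \<in> borel_measurable borel" "A \<in> sets borel" and A: "A \<subseteq> {0..}"
  shows "(\<integral>\<^sup>+x\<in>A. ennreal (h x) \<partial>age_law f) = (\<integral>\<^sup>+x\<in>A. ennreal (f x * h x) \<partial>lborel)"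
proof -
  have "(\<integral>\<^sup>+x\<in>A. ennreal (h x) \<partial>age_law f)
      = (\<integral>\<^sup>+x. ennreal (indicator {0..} x * f x) * (ennreal (h x) * indicator A x) \<partial>lborel)"
    unfolding age_law_alt using set_borel_measurable_Ici[OF f(1)]
    by (intro nn_integral_density) auto
  also have "\<dots> = (\<integral>\<^sup>+x\<in>A. ennreal (f x * h x) \<partial>lborel)"
    by (intro nn_integral_cong) (use A f(2) in \<open>auto simp: indicator_def ennreal_mult' subset_iff\<close>)
  finally show ?thesis .
qed

lemma age_measureD:
  assumes "age_measure G M"
  shows "sets M = sets borel" "finite_measure M" "emeasure M (- ages G) = 0"
  using assms by (auto simp: age_measure_def)

lemma (in lifetime) age_measure_negative:
  assumes "age_measure G M"
  shows "emeasure M (- {0..}) = 0"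
  by (rule emeasure_eq_0[OF _ age_measureD(3)[OF assms]])
    (use ages_measurable age_measureD(1)[OF assms] in \<open>auto simp: ages_def\<close>)

locale fluid_model =
  fixes Gs gs Gr gr lam X qt0 b0 :: "real \<Rightarrow> real"
    and \<eta> \<nu> :: "real \<Rightarrow> real measure"
  assumes service_law: "lifetime_law Gs gs" and patience_law: "lifetime_law Gr gr"
    and arrival: "arrival_rate lam"
    and model: "measure_valued_fluid_model Gs gs Gr gr lam \<eta> \<nu> X"
    and initial: "(\<eta> 0, \<nu> 0, X 0) \<in> initial_states Gr Gs"
    and \<eta>0: "has_age_density (\<eta> 0) qt0" and \<nu>0: "has_age_density (\<nu> 0) b0"
begin

sublocale s: lifetime Gs gs by unfold_locales (rule service_law)
sublocale r: lifetime Gr gr by unfold_locales (rule patience_law)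

lemma
  assumes "0 \<le> t"
  shows age_measure_\<eta>: "age_measure Gr (\<eta> t)" and age_measure_\<nu>: "age_measure Gs (\<nu> t)"
    and flow: "arrivals lam t + queue X 0 = queue X t + service_entries Gs gs \<nu> t + cumulative (reneging_rate Gr gr \<eta> X) t"
    and busy_eq: "busy \<nu> t = min (X t) 1"
  using model assms unfolding measure_valued_fluid_model_def by blast+

definition "\<sigma> = departure_rate Gs gs \<nu>"
definition "\<rho> = reneging_rate Gr gr \<eta> X"
definition "w = head_age Gr \<eta> X"

lemma locally_integrable: "locally_integrable_rate \<sigma>" "locally_integrable_rate \<rho>"
  using model unfolding measure_valued_fluid_model_def \<sigma>_def \<rho>_def by blast+

text \<open>Nothing is known of \<open>lam\<close> at negative times, whereas an inflow of
  \<open>aged_population\<close> has to be measurable and nonnegative on the whole line.\<close>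

definition "lam0 s = indicator {0..} s * lam s"

lemma lam_nonneg: "0 \<le> t \<Longrightarrow> 0 \<le> lam t"
  using arrival by (simp add: arrival_rate_def)

lemma indefinite_integral_arrivals: "indefinite_integral (arrivals lam) lam"
  using arrival set_integral_discrete_difference[of "{0}" "{0..0::real}" "{}" lborel lam]
  unfolding indefinite_integral_def arrival_rate_def arrivals_def
  by (auto simp: set_lebesgue_integral_def)

section \<open>The density of the patience population\<close>

sublocale r: aged_population Gr gr lam0 qt0
proof
  show "lam0 \<in> borel_measurable borel"
    unfolding lam0_def[abs_def] by (rule indefinite_integral_measurable[OF indefinite_integral_arrivals])
  show "0 \<le> lam0 s" for s using lam_nonneg by (simp add: lam0_def indicator_def)
  have "set_integrable lborel {0..t} lam" for t
    by (rule indefinite_integral_integrable[OF indefinite_integral_arrivals])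
  then show "set_integrable lborel {0..t} lam0" for t
    by (subst set_integrable_cong[where f'=lam and M'=lborel and A'="{0..t}"]) (auto simp: lam0_def)
  show "qt0 \<in> borel_measurable borel" "0 \<le> x \<Longrightarrow> 0 \<le> qt0 x" for x
    using \<eta>0 by (auto simp: has_age_density_def)
  show "set_integrable lborel {0..} qt0"
    by (rule has_age_density_age_law[OF \<eta>0 age_measureD(2)[OF age_measure_\<eta>]]) simp
qed

abbreviation "qt \<equiv> r.aged lam0 qt0"

lemmas qt_integrable = r.aged_integrable and qt_nonneg = r.aged_nonneg

text \<open>Neither the queue nor \<open>K\<close> enters this equation, so absolute continuity of
  \<open>\<eta>\<^sub>t\<close> is known before anything about the service side.\<close>

lemma \<eta>_eq:
  assumes t: "0 \<le> t"
  shows "\<eta> t = age_law (qt t)"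
proof (rule measure_eq_age_lawI)
  show "sets (\<eta> t) = sets borel" "finite_measure (\<eta> t)" "emeasure (\<eta> t) (- {0..}) = 0"
    by (rule age_measureD[OF age_measure_\<eta>[OF t]] r.age_measure_negative[OF age_measure_\<eta>[OF t]])+
  show "set_integrable lborel {0..} (qt t)" "\<And>x. 0 \<le> x \<Longrightarrow> 0 \<le> qt t x"
    using t by (auto intro: qt_integrable qt_nonneg)
  fix \<psi> :: "real \<Rightarrow> real"
  assume c: "continuous_on UNIV \<psi>" and b: "\<And>x. 0 \<le> \<psi> x \<and> \<psi> x \<le> 1"
  have "continuous_on {0..} \<psi>" by (rule continuous_on_subset[OF c]) simp
  moreover have "bounded (\<psi> ` {0..})"
    using b by (intro boundedI[where B=1]) auto
  ultimately have "(LINT x:{0..}|\<eta> t. \<psi> x) =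
      (LINT x:ages Gr|\<eta> 0. \<psi> (x + t) * (surv Gr (x + t) / surv Gr x)) +
      (LINT s:{0..t}|lborel. \<psi> (t - s) * surv Gr (t - s) * lam s)"
    using model t unfolding measure_valued_fluid_model_def by blast
  also have "\<eta> 0 = age_law qt0"
    by (rule has_age_density_age_law[OF \<eta>0 age_measureD(2)[OF age_measure_\<eta>]]) simp
  also have "(LINT s:{0..t}|lborel. \<psi> (t - s) * surv Gr (t - s) * lam s)
      = (LINT s:{0..t}|lborel. \<psi> (t - s) * surv Gr (t - s) * lam0 s)"
    by (intro set_lebesgue_integral_cong) (auto simp: lam0_def)
  also have "(LINT x:ages Gr|age_law qt0. \<psi> (x + t) * (surv Gr (x + t) / surv Gr x)) + \<dots>
      = (LINT x:{0..}|lborel. \<psi> x * qt t x)"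
    by (rule r.integral_aged[OF t borel_measurable_continuous_onI[OF c] b, symmetric])
  finally show "(LINT x:{0..}|\<eta> t. \<psi> x) = (LINT x:{0..}|lborel. \<psi> x * qt t x)" .
qed

lemma measure_\<eta>:
  "0 \<le> t \<Longrightarrow> A \<in> sets borel \<Longrightarrow> A \<subseteq> {0..} \<Longrightarrow> measure (\<eta> t) A = (LINT x:A|lborel. qt t x)"
  using measure_age_law[OF qt_integrable qt_nonneg] by (simp add: \<eta>_eq)

section \<open>The state process and the rate of entry into service\<close>

lemma indefinite_integral_X: "indefinite_integral X (\<lambda>s. lam s - enn2real (\<sigma> s) - enn2real (\<rho> s))"
proof (rule indefinite_integral_shift[OF indefinite_integral_diff[OF indefinite_integral_diff[OF
      indefinite_integral_arrivals indefinite_integral_cumulative[OF locally_integrable(1)]]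
      indefinite_integral_cumulative[OF locally_integrable(2)]]])
  fix t :: real assume t: "0 \<le> t"
  have X: "X t = queue X t + busy \<nu> t" if "0 \<le> t" for t
    using busy_eq[OF that] by (auto simp: queue_def)
  show "X t - X 0 = arrivals lam t - cumulative \<sigma> t - cumulative \<rho> t - (arrivals lam 0 - cumulative \<sigma> 0 - cumulative \<rho> 0)"
    using flow[OF t] flow[of 0] X[OF t] X[of 0] by (simp add: service_entries_def \<sigma>_def \<rho>_def)
qed

lemma head_age_nonneg: "0 \<le> w t"
  unfolding w_def head_age_def by (rule INF_greatest) (auto simp: ages_def)

lemma head_age_empty_queue:
  assumes "X t \<le> 1"
  shows "w t = 0"
proof -
  have "queue X t = 0" using assms by (simp add: queue_def)
  then have "w t \<le> ereal 0"
    unfolding w_def head_age_def using r.zero_in_ages by (intro INF_lower) auto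
  with head_age_nonneg[of t] show ?thesis by (simp add: zero_ereal_def)
qed

lemma reneging_rate_eq:
  assumes t: "0 \<le> t"
  shows "\<rho> t = (\<integral>\<^sup>+x\<in>{x \<in> ages Gr. ereal x \<le> w t}. ennreal (qt t x * hazard Gr gr x) \<partial>lborel)"
proof -
  have "{x \<in> ages Gr. ereal x \<le> w t} = ages Gr \<inter> {x. ereal x \<le> w t}" by auto
  then have "{x \<in> ages Gr. ereal x \<le> w t} \<in> sets borel" by (simp add: sets.Int)
  then show ?thesis
    unfolding \<rho>_def reneging_rate_def \<eta>_eq[OF t] w_def[symmetric]
    by (intro nn_integral_age_law qt_integrable qt_nonneg t) (auto simp: ages_def)
qed

text \<open>The head age is 0 because the level 0 is reached at age 0. Only this one age remains in
  the integral, and \<open>\<eta>\<^sub>t\<close> has a density, so the integral vanishes whatever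
  the hazard at 0 is.\<close>

lemma reneging_rate_empty_queue:
  assumes t: "0 \<le> t" "X t \<le> 1"
  shows "\<rho> t = 0"
proof -
  have "\<rho> t = (\<integral>\<^sup>+x. 0 \<partial>(lborel :: real measure))"
    unfolding reneging_rate_eq[OF t(1)] head_age_empty_queue[OF t(2)]
    by (rule nn_integral_cong_AE, use AE_lborel_singleton[of "0::real"] in eventually_elim)
      (auto simp: indicator_def ages_def)
  then show ?thesis by simp
qed

text \<open>These are the boundary values prescribed for \<open>b t 0\<close>, with the conditions
  on the masses expressed through \<open>X\<close>. The minimum is finite because
  \<open>lam t\<close> is; in the last case an infinite \<open>\<sigma> t\<close> becomes 0, which
  concerns a null set of times.\<close>

definition "\<beta> t =
  (if t < 0 then 0 else if X t < 1 then lam t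
   else if X t = 1 then enn2real (min (\<sigma> t) (ennreal (lam t))) else enn2real (\<sigma> t))"

lemma \<beta>_nonneg: "0 \<le> \<beta> t"
  using lam_nonneg by (simp add: \<beta>_def)

text \<open>\<open>X\<close>, \<open>lam\<close> and \<open>\<sigma>\<close> are controlled on the
  half-line only. The expression is therefore rewritten with versions that are measurable on the
  whole line and agree at nonnegative times.\<close>

lemma \<beta>_measurable: "\<beta> \<in> borel_measurable borel"
proof -
  have "continuous_on UNIV (\<lambda>t. X (max 0 t))"
    by (rule continuous_on_compose2[OF indefinite_integral_continuous[OF indefinite_integral_X]])
      (auto intro!: continuous_intros)
  then have [measurable]: "(\<lambda>t. X (max 0 t)) \<in> borel_measurable borel"
    by (rule borel_measurable_continuous_onI)
  have [measurable]: "(\<lambda>t. \<sigma> t * indicator {0..} t) \<in> borel_measurable borel"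
    by (rule locally_integrable_rate_measurable[OF locally_integrable(1)])
  have "(\<lambda>t. if t < 0 then 0 else if X (max 0 t) < 1 then lam0 t
    else if X (max 0 t) = 1 then enn2real (min (\<sigma> t * indicator {0..} t) (ennreal (lam0 t)))
    else enn2real (\<sigma> t * indicator {0..} t)) \<in> borel_measurable borel"
    by measurable
  also have "(\<lambda>t. if t < 0 then 0 else if X (max 0 t) < 1 then lam0 t
    else if X (max 0 t) = 1 then enn2real (min (\<sigma> t * indicator {0..} t) (ennreal (lam0 t)))
    else enn2real (\<sigma> t * indicator {0..} t)) = \<beta>"
    by (auto simp: \<beta>_def lam0_def fun_eq_iff)
  finally show ?thesis .
qed

lemma indefinite_integral_queue:
  "indefinite_integral (queue X) (\<lambda>s. indicator {1<..} (X s) * (lam s - enn2real (\<sigma> s) - enn2real (\<rho> s)))"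
  using indefinite_integral_excess[OF indefinite_integral_X, of 1] by (simp add: queue_def[abs_def])

lemma indefinite_integral_service_entries: "indefinite_integral (service_entries Gs gs \<nu>) \<beta>"
proof (rule indefinite_integral_cong_AE[where G="service_entries Gs gs \<nu>"])
  let ?x = "\<lambda>s. lam s - enn2real (\<sigma> s) - enn2real (\<rho> s)"
  show "indefinite_integral (service_entries Gs gs \<nu>)
    (\<lambda>s. ?x s - indicator {1<..} (X s) * ?x s + enn2real (\<sigma> s))"
  proof (rule indefinite_integral_shift[OF indefinite_integral_add[OF indefinite_integral_diff[OF
        indefinite_integral_X indefinite_integral_queue]
        indefinite_integral_cumulative[OF locally_integrable(1)]]])
    fix t :: real assume t: "0 \<le> t"
    have "busy \<nu> t = X t - queue X t" if "0 \<le> t" for t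
      using busy_eq[OF that] by (auto simp: queue_def)
    from this[OF t] this[of 0] show "service_entries Gs gs \<nu> t - service_entries Gs gs \<nu> 0
      = X t - queue X t + cumulative \<sigma> t - (X 0 - queue X 0 + cumulative \<sigma> 0)"
      by (simp add: service_entries_def \<sigma>_def)
  qed
  show "AE s in lborel. 0 \<le> s \<longrightarrow>
      ?x s - indicator {1<..} (X s) * ?x s + enn2real (\<sigma> s) = \<beta> s"
    using indefinite_integral_level_set[OF indefinite_integral_X, of 1]
      locally_integrable_rate_AE_finite[OF locally_integrable(1)]
  proof eventually_elim
    case (elim s)
    show ?case
    proof
      assume s: "0 \<le> s"
      consider "X s < 1" | "X s = 1" | "X s > 1" by linarith
      then show "?x s - indicator {1<..} (X s) * ?x s + enn2real (\<sigma> s) = \<beta> s"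
      proof cases
        case 1
        then show ?thesis using s reneging_rate_empty_queue[OF s] by (simp add: \<beta>_def)
      next
        case 2
        then have "enn2real (\<sigma> s) = lam s"
          using elim s reneging_rate_empty_queue[OF s] by simp
        \<comment> \<open>The value of \<open>enn2real\<close> determines \<open>\<sigma> s\<close>
          only if it is finite, which holds at almost every time.\<close>
        moreover from this have "\<sigma> s = ennreal (lam s)"
          using elim s by (metis ennreal_enn2real infinity_ennreal_def)
        ultimately show ?thesis
          using 2 s reneging_rate_empty_queue[OF s] lam_nonneg[OF s] by (simp add: \<beta>_def)
      next
        case 3
        then show ?thesis using s by (simp add: \<beta>_def)
      qed
    qed
  qed
  show "(\<lambda>s. indicator {0..t} s * \<beta> s) \<in> borel_measurable lborel" for t
    using \<beta>_measurable by simp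
qed simp

section \<open>The density of the population in service\<close>

sublocale s: aged_population Gs gs \<beta> b0
proof
  show "\<beta> \<in> borel_measurable borel" "0 \<le> \<beta> t" for t
    by (rule \<beta>_measurable \<beta>_nonneg)+
  show "set_integrable lborel {0..t} \<beta>" for t
    by (rule indefinite_integral_integrable[OF indefinite_integral_service_entries])
  show "b0 \<in> borel_measurable borel" "0 \<le> x \<Longrightarrow> 0 \<le> b0 x" for x
    using \<nu>0 by (auto simp: has_age_density_def)
  show "set_integrable lborel {0..} b0"
    by (rule has_age_density_age_law[OF \<nu>0 age_measureD(2)[OF age_measure_\<nu>]]) simp
qed

abbreviation "b \<equiv> s.aged \<beta> b0"

lemmas b_integrable = s.aged_integrable and b_nonneg = s.aged_nonneg

text \<open>Monotonicity of \<open>K\<close>, needed for its Stieltjes measure, comes from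
  \<open>\<beta> \<ge> 0\<close>.\<close>

lemma interval_measure_service_entries:
  "interval_measure (\<lambda>s. service_entries Gs gs \<nu> (max 0 s)) = age_law \<beta>"
  by (rule interval_measure_indefinite_integral[OF indefinite_integral_service_entries \<beta>_nonneg])

lemma \<nu>_eq:
  assumes t: "0 \<le> t"
  shows "\<nu> t = age_law (b t)"
proof (rule measure_eq_age_lawI)
  show "sets (\<nu> t) = sets borel" "finite_measure (\<nu> t)" "emeasure (\<nu> t) (- {0..}) = 0"
    by (rule age_measureD[OF age_measure_\<nu>[OF t]] s.age_measure_negative[OF age_measure_\<nu>[OF t]])+
  show "set_integrable lborel {0..} (b t)" "\<And>x. 0 \<le> x \<Longrightarrow> 0 \<le> b t x"
    using t by (auto intro: b_integrable b_nonneg)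
  fix \<psi> :: "real \<Rightarrow> real"
  assume c: "continuous_on UNIV \<psi>" and bd: "\<And>x. 0 \<le> \<psi> x \<and> \<psi> x \<le> 1"
  have [measurable]: "\<psi> \<in> borel_measurable borel" by (rule borel_measurable_continuous_onI[OF c])
  have "continuous_on {0..} \<psi>" by (rule continuous_on_subset[OF c]) simp
  moreover have "bounded (\<psi> ` {0..})"
    using bd by (intro boundedI[where B=1]) auto
  ultimately have "(LINT x:{0..}|\<nu> t. \<psi> x) =
      (LINT x:ages Gs|\<nu> 0. \<psi> (x + t) * (surv Gs (x + t) / surv Gs x)) +
      (LINT s:{0..t}|interval_measure (\<lambda>s. service_entries Gs gs \<nu> (max 0 s)). \<psi> (t - s) * surv Gs (t - s))"
    using model t unfolding measure_valued_fluid_model_def by blast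
  also have "\<nu> 0 = age_law b0"
    by (rule has_age_density_age_law[OF \<nu>0 age_measureD(2)[OF age_measure_\<nu>]]) simp
  also have "(LINT s:{0..t}|interval_measure (\<lambda>s. service_entries Gs gs \<nu> (max 0 s)). \<psi> (t - s) * surv Gs (t - s))
      = (LINT s|lborel. (indicator {0..} s * \<beta> s) *\<^sub>R (indicator {0..t} s *\<^sub>R (\<psi> (t - s) * surv Gs (t - s))))"
    unfolding interval_measure_service_entries age_law_alt set_lebesgue_integral_def
    using \<beta>_measurable \<beta>_nonneg by (intro integral_density) (auto simp: indicator_def)
  also have "\<dots> = (LINT s:{0..t}|lborel. \<psi> (t - s) * surv Gs (t - s) * \<beta> s)"
    unfolding set_lebesgue_integral_def by (intro Bochner_Integration.integral_cong) (auto simp: indicator_def)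
  also have "(LINT x:ages Gs|age_law b0. \<psi> (x + t) * (surv Gs (x + t) / surv Gs x)) + \<dots>
      = (LINT x:{0..}|lborel. \<psi> x * b t x)"
    by (rule s.integral_aged[OF t borel_measurable_continuous_onI[OF c] bd, symmetric])
  finally show "(LINT x:{0..}|\<nu> t. \<psi> x) = (LINT x:{0..}|lborel. \<psi> x * b t x)" .
qed

lemma measure_\<nu>:
  "0 \<le> t \<Longrightarrow> A \<in> sets borel \<Longrightarrow> A \<subseteq> {0..} \<Longrightarrow> measure (\<nu> t) A = (LINT x:A|lborel. b t x)"
  using measure_age_law[OF b_integrable b_nonneg] by (simp add: \<nu>_eq)

lemma mass_b: "0 \<le> t \<Longrightarrow> mass (b t) = min (X t) 1"
  using measure_\<nu>[of t "{0..}"] busy_eq[of t] by (simp add: busy_def mass_def)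

lemma hazard_flow_b: "0 \<le> t \<Longrightarrow> hazard_flow Gs gs b t = \<sigma> t"
  unfolding \<sigma>_def departure_rate_def hazard_flow_def \<nu>_eq
  by (rule nn_integral_age_law[symmetric]) (auto intro: b_integrable b_nonneg simp: ages_def)

section \<open>The queue as the part of \<open>\<eta>\<close> below the head age\<close>

lemma mass_qt: "0 \<le> t \<Longrightarrow> mass (qt t) = measure (\<eta> t) {0..}"
  using measure_\<eta>[of t "{0..}"] by (simp add: mass_def)

lemma measure_\<eta>_le_mass:
  assumes "0 \<le> t"
  shows "measure (\<eta> t) A \<le> mass (qt t)"
proof -
  interpret finite_measure "\<eta> t" by (rule age_measureD(2)[OF age_measure_\<eta>[OF assms]])
  have [simp]: "sets (\<eta> t) = sets borel" "space (\<eta> t) = UNIV" by (simp_all add: \<eta>_eq assms)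
  have "measure (\<eta> t) UNIV = measure (\<eta> t) {0..} + measure (\<eta> t) (- {0..})"
    using finite_measure_Union[of "{0..}" "- {0..}"] by (simp add: Compl_partition del: Compl_atLeast)
  also have "measure (\<eta> t) (- {0..}) = 0"
    using r.age_measure_negative[OF age_measure_\<eta>[OF assms]] by (simp add: measure_def)
  finally show ?thesis using bounded_measure[of A] by (simp add: mass_qt assms)
qed

text \<open>The two equations of the initial state give \<open>\<nu>\<^sub>0\<close> the mass
  \<open>min (X 0) 1\<close>, which leaves the excess of \<open>X 0\<close> over 1 to
  \<open>\<eta>\<^sub>0\<close>.\<close>

lemma initial_queue: "queue X 0 = mass (qt 0)"
proof -
  have "1 - measure (\<nu> 0) (ages Gs) = max (1 - X 0) 0" "measure (\<nu> 0) (ages Gs) + measure (\<eta> 0) (ages Gr) = X 0"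
    using initial by (auto simp: initial_states_def)
  then have "queue X 0 = measure (\<eta> 0) (ages Gr)" by (auto simp: queue_def)
  also have "\<dots> = (LINT x:ages Gr|lborel. qt 0 x)" by (rule measure_\<eta>) (auto simp: ages_def)
  also have "\<dots> = mass (qt 0)"
    unfolding mass_def set_lebesgue_integral_def
    by (intro Bochner_Integration.integral_cong) (auto simp: indicator_def ages_def r.aged_eq_0[unfolded ages_def])
  finally show ?thesis .
qed

text \<open>While the queue exceeds the total mass of \<open>\<eta>\<close>, the head age is infinite and \<open>\<rho>\<close> is
  the full hazard flow of \<open>\<eta>\<close>, so the difference of the two decreases at rate \<open>\<sigma>\<close>.\<close>

lemma queue_le_mass:
  assumes t: "0 \<le> t"
  shows "queue X t \<le> mass (qt t)"
proof -
  let ?Z = "\<lambda>t. queue X t - mass (qt t)"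
  let ?z = "\<lambda>s. indicator {1<..} (X s) * (lam s - enn2real (\<sigma> s) - enn2real (\<rho> s)) -
    (lam0 s - enn2real (hazard_flow Gr gr qt s))"
  have "indefinite_integral ?Z ?z"
    by (rule indefinite_integral_diff[OF indefinite_integral_queue r.indefinite_integral_aged_mass])
  \<comment> \<open>The positive part of the difference starts at 0 and changes only while the
    difference is positive, so it is enough to find the sign of the derivative at those
    times.\<close>
  from indefinite_integralD[OF indefinite_integral_excess[OF this, of 0] t]
  have "max (?Z t) 0 = (LINT s:{0..t}|lborel. indicator {0<..} (?Z s) * ?z s)"
    using initial_queue by simp
  also have "\<dots> \<le> 0"
  proof -
    have "indicator {0..t} s *\<^sub>R (indicator {0<..} (?Z s) * ?z s) \<le> 0" for s
    proof (cases "0 \<le> s \<and> ?Z s > 0")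
      case True
      then have s: "0 \<le> s" and Z: "mass (qt s) < queue X s" by auto
      have "0 \<le> mass (qt s)" by (simp add: mass_qt s)
      with Z have X: "X s > 1" by (auto simp: queue_def max_def split: if_splits)
      have "queue X s > measure (\<eta> s) {0..x}" for x
        using measure_\<eta>_le_mass[OF s, of "{0..x}"] Z by simp
      then have "w s = \<infinity>" unfolding w_def head_age_def by (simp add: not_le[symmetric] top_ereal_def)
      then have "\<rho> s = hazard_flow Gr gr qt s"
        by (simp add: reneging_rate_eq s hazard_flow_def)
      then show ?thesis using X s by (simp add: lam0_def indicator_def)
    qed (auto simp: indicator_def)
    then have "0 \<le> (LINT s|lborel. - (indicator {0..t} s *\<^sub>R (indicator {0<..} (?Z s) * ?z s)))"
      by (intro integral_nonneg_AE) simp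
    then show ?thesis by (simp add: set_lebesgue_integral_def)
  qed
  finally show ?thesis by simp
qed

lemma indefinite_integral_distribution_\<eta>:
  assumes t: "0 \<le> t"
  shows "indefinite_integral (\<lambda>y. measure (\<eta> t) {0..y}) (qt t)"
  unfolding indefinite_integral_def
proof (intro allI impI conjI)
  fix y :: real assume "0 \<le> y"
  show "set_integrable lborel {0..y} (qt t)"
    by (rule set_integrable_subset[OF qt_integrable[OF t]]) auto
  show "measure (\<eta> t) {0..y} = measure (\<eta> t) {0..0} + (LINT x:{0..y}|lborel. qt t x)"
    using measure_\<eta>[OF t, of "{0..y}"] measure_\<eta>[OF t, of "{0..0}"]
      set_integral_discrete_difference[of "{0}" "{0..0::real}" "{}" lborel "qt t"]
    by (simp add: set_lebesgue_integral_def)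
qed

lemma measure_\<eta>_0: "0 \<le> t \<Longrightarrow> measure (\<eta> t) {0} = 0"
  using measure_\<eta>[of t "{0..0}"]
    set_integral_discrete_difference[of "{0}" "{0..0::real}" "{}" lborel "qt t"]
  by (simp add: set_lebesgue_integral_def)

text \<open>Intermediate value theorem: the distribution function of \<open>\<eta>\<^sub>t\<close>
  is continuous and starts at 0, there being no atom at age 0.\<close>

lemma queue_attained:
  assumes t: "0 \<le> t" and Q: "0 < queue X t" and y: "0 \<le> y" "queue X t \<le> measure (\<eta> t) {0..y}"
  shows "\<exists>x. 0 \<le> x \<and> x \<le> y \<and> measure (\<eta> t) {0..x} = queue X t"
proof -
  have "continuous_on {0..y} (\<lambda>y. measure (\<eta> t) {0..y})"
    by (rule continuous_on_subset[OF indefinite_integral_continuous[OF indefinite_integral_distribution_\<eta>[OF t]]]) auto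
  then show ?thesis
    using IVT'[of "\<lambda>y. measure (\<eta> t) {0..y}" 0 "queue X t" y] Q y measure_\<eta>_0[OF t] by auto
qed

text \<open>If some age reaches the level \<open>queue X t\<close>, continuity of the distribution
  function makes the level exact at the infimum. If none does, the head age is infinite and everyone
  counts as waiting; then \<open>queue_le_mass\<close> is what excludes a queue larger than the
  total mass.\<close>

lemma measure_waiting:
  assumes t: "0 \<le> t"
  shows "measure (\<eta> t) {x. 0 \<le> x \<and> ereal x \<le> w t} = queue X t"
proof (cases "queue X t = 0")
  case True
  then have "w t = 0" by (intro head_age_empty_queue) (auto simp: queue_def max_def split: if_splits)
  then have "{x. 0 \<le> x \<and> ereal x \<le> w t} = {0}" by auto
  then show ?thesis using True measure_\<eta>_0[OF t] by simp
next
  case False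
  then have Q: "0 < queue X t" by (auto simp: queue_def max_def split: if_splits)
  interpret M: finite_borel_measure "\<eta> t"
    using age_measureD[OF age_measure_\<eta>[OF t]]
    by (simp add: finite_borel_measure_def finite_borel_measure_axioms_def)
  define m where "m y = measure (\<eta> t) {0..y}" for y
  define S where "S = {x \<in> ages Gr. queue X t \<le> m x}"
  have w: "w t = (INF x\<in>S. ereal x)" by (simp add: w_def head_age_def S_def m_def)
  have mono: "m x \<le> m y" if "x \<le> y" for x y
    unfolding m_def using that by (intro M.finite_measure_mono) auto
  show ?thesis
  proof (cases "S = {}")
    case True
    have "\<not> queue X t < mass (qt t)"
    proof
      assume less: "queue X t < mass (qt t)"
      have "(\<lambda>n. m (real n)) \<longlonglongrightarrow> measure (\<eta> t) (\<Union>n. {0..real n})"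
        unfolding m_def by (rule M.finite_Lim_measure_incseq) (auto simp: incseq_def)
      also have "(\<Union>n. {0..real n}) = {0..}" by (auto intro: real_arch_simple)
      finally have "(\<lambda>n. m (real n)) \<longlonglongrightarrow> mass (qt t)" by (simp add: mass_qt t)
      then have "\<forall>\<^sub>F n in sequentially. queue X t < m (real n)" using less by (rule order_tendstoD)
      then obtain n where "queue X t < m (real n)" by (auto dest: eventually_happens)
      then obtain x where x: "0 \<le> x" "m x = queue X t"
        using queue_attained[OF t Q, of "real n"] by (auto simp: m_def)
      \<comment> \<open>A level attained only outside the ages would already be the full mass: the
        ages form an initial segment, so everything beyond \<open>x\<close> is outside them too and
        is null. This contradicts \<open>less\<close>.\<close>
      with True have "x \<notin> ages Gr" by (auto simp: S_def)
      then have sub: "{x<..} \<subseteq> - ages Gr" using r.ages_down[OF _ x(1)] by (meson ComplI greaterThan_iff less_imp_le subsetI)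
      have "- ages Gr \<in> sets (\<eta> t)"
        using r.ages_measurable by (simp add: age_measureD(1)[OF age_measure_\<eta>[OF t]])
      from emeasure_eq_0[OF this age_measureD(3)[OF age_measure_\<eta>[OF t]] sub]
      have "emeasure (\<eta> t) {x<..} = 0" .
      moreover have "measure (\<eta> t) ({0..x} \<union> {x<..}) = m x + measure (\<eta> t) {x<..}"
        unfolding m_def by (rule M.finite_measure_Union) auto
      moreover have "{0..x} \<union> {x<..} = {0..}" using x(1) by auto
      ultimately show False using less x mass_qt[OF t] by (simp add: measure_def)
    qed
    with queue_le_mass[OF t] have "queue X t = mass (qt t)" by simp
    moreover have "{x. 0 \<le> x \<and> ereal x \<le> w t} = {0..}" by (auto simp: w True top_ereal_def)
    ultimately show ?thesis by (simp add: mass_qt t)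
  next
    case False
    define c where "c = Inf S"
    have bdd: "bdd_below S" by (auto simp: S_def ages_def intro!: bdd_belowI[of _ 0])
    have c0: "0 \<le> c" unfolding c_def using False by (intro cInf_greatest) (auto simp: S_def ages_def)
    have wc: "w t = ereal c"
      unfolding w
    proof (rule antisym)
      show "ereal c \<le> (INF x\<in>S. ereal x)"
        unfolding c_def by (rule INF_greatest) (auto intro: cInf_lower bdd)
      show "(INF x\<in>S. ereal x) \<le> ereal c"
      proof (rule ereal_le_epsilon2)
        fix e :: real assume "0 < e"
        then obtain x where "x \<in> S" "x < c + e"
          unfolding c_def using cInf_less_iff[OF False bdd, of "Inf S + e"] by auto
        then show "(INF x\<in>S. ereal x) \<le> ereal c + ereal e"
          by (intro INF_lower2[of x]) auto
      qed
    qed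
    have cont: "continuous_on {0..} m"
      unfolding m_def by (rule indefinite_integral_continuous[OF indefinite_integral_distribution_\<eta>[OF t]])
    \<comment> \<open>Closedness passes the inequality defining \<open>S\<close> to its infimum,
      even if the infimum were not attained in \<open>S\<close>.\<close>
    have cl: "closed ({0..} \<inter> m -` {queue X t..})"
      by (rule continuous_closed_preimage[OF cont]) auto
    have "S \<subseteq> {0..} \<inter> m -` {queue X t..}" by (auto simp: S_def ages_def)
    then have "closure S \<subseteq> {0..} \<inter> m -` {queue X t..}" using cl by (rule closure_minimal)
    then have ge: "queue X t \<le> m c"
      using closure_contains_Inf[OF False bdd] by (auto simp: c_def)
    obtain x where x: "x \<in> S" using False by auto
    then obtain y where y: "0 \<le> y" "y \<le> x" "m y = queue X t"
      using queue_attained[OF t Q, of x] by (auto simp: S_def m_def ages_def)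
    have "y \<in> S" using y x r.ages_down[of x y] by (auto simp: S_def)
    then have "c \<le> y" unfolding c_def by (rule cInf_lower[OF _ bdd])
    then have "m c \<le> queue X t" using mono y by metis
    with ge have "m c = queue X t" by simp
    moreover have "{x. 0 \<le> x \<and> ereal x \<le> w t} = {0..c}" by (auto simp: wc)
    ultimately show ?thesis by (simp add: m_def)
  qed
qed

text \<open>Age 0 is separated because the cut at the head age would give a wrong value there: with
  an empty queue \<open>w t = 0\<close>, and \<open>0 \<le> w t\<close> would select
  \<open>qt t 0 = lam t\<close> instead of the prescribed boundary value.\<close>

definition "q t x =
  (if x = 0
   then (if X t > 1 then lam t else if X t = 1 then lam t - enn2real (min (\<sigma> t) (ennreal (lam t))) else 0)
   else if ereal x \<le> w t then qt t x else 0)"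

lemma AE_q: "AE x in lborel. q t x = indicator {x. ereal x \<le> w t} x * qt t x"
  using AE_lborel_singleton[of "0::real"] by eventually_elim (auto simp: q_def)

lemma q_measurable [measurable]: "q t \<in> borel_measurable borel"
proof -
  have "q t = (\<lambda>x. if x \<in> {0} then q t 0 else indicator {x. ereal x \<le> w t} x * qt t x)"
    by (auto simp: q_def)
  also have "\<dots> \<in> borel_measurable borel" by measurable
  finally show ?thesis .
qed

lemma q_nonneg: "0 \<le> t \<Longrightarrow> 0 \<le> x \<Longrightarrow> 0 \<le> q t x"
  using lam_nonneg[of t] qt_nonneg[of t x] enn2real_leI[of "lam t" "min (\<sigma> t) (ennreal (lam t))"]
  by (auto simp: q_def)

lemma q_integrable:
  assumes t: "0 \<le> t"
  shows "set_integrable lborel {0..} (q t)"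
  unfolding set_integrable_def
proof (rule integrable_cong_AE_imp)
  show "integrable lborel (\<lambda>x. indicator {x. ereal x \<le> w t} x *\<^sub>R (indicator {0..} x *\<^sub>R qt t x))"
    using qt_integrable[OF t] unfolding set_integrable_def by (rule integrable_mult_indicator[rotated]) simp
  show "AE x in lborel. indicator {x. ereal x \<le> w t} x *\<^sub>R (indicator {0..} x *\<^sub>R qt t x) = indicator {0..} x *\<^sub>R q t x"
    using AE_q[of t] by eventually_elim auto
qed simp

lemma integral_q:
  assumes t: "0 \<le> t" and A: "A \<in> sets borel" "A \<subseteq> {0..}"
  shows "(LINT x:A|lborel. q t x) = measure (\<eta> t) (A \<inter> {x. ereal x \<le> w t})"
proof -
  have "(LINT x:A|lborel. q t x) = (LINT x:A \<inter> {x. ereal x \<le> w t}|lborel. qt t x)"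
    unfolding set_lebesgue_integral_def
  proof (rule integral_cong_AE)
    show "AE x in lborel. indicator A x *\<^sub>R q t x = indicator (A \<inter> {x. ereal x \<le> w t}) x *\<^sub>R qt t x"
      using AE_q[of t] by eventually_elim (auto simp: indicator_def)
  qed (use A in auto)
  also have "\<dots> = measure (\<eta> t) (A \<inter> {x. ereal x \<le> w t})"
    using A by (intro measure_\<eta>[symmetric] t) auto
  finally show ?thesis .
qed

lemma mass_q: "0 \<le> t \<Longrightarrow> mass (q t) = queue X t"
  using integral_q[of t "{0..}"] measure_waiting[of t]
  by (simp add: mass_def Int_def)

lemma hazard_flow_q:
  assumes t: "0 \<le> t"
  shows "hazard_flow Gr gr q t = \<rho> t"
  unfolding hazard_flow_def reneging_rate_eq[OF t]
  by (rule nn_integral_cong_AE, use AE_q[of t] in eventually_elim) (auto simp: indicator_def)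

section \<open>Verification of the two-parameter model\<close>

lemma initial_density_off_ages:
  assumes "lifetime G g" "age_measure G (age_law f)" "set_integrable lborel {0..} f" "\<And>x. 0 \<le> x \<Longrightarrow> 0 \<le> f x"
  shows "AE x in lborel. 0 \<le> x \<longrightarrow> x \<notin> ages G \<longrightarrow> f x = 0"
proof -
  note [measurable] = set_borel_measurable_Ici[OF assms(3)] lifetime.ages_measurable[OF assms(1)]
  have "(\<integral>\<^sup>+x\<in>- ages G. ennreal (indicator {0..} x * f x) \<partial>lborel) = 0"
    using age_measureD(3)[OF assms(2)] unfolding age_law_alt by (subst (asm) emeasure_density) auto
  then have "AE x in lborel. ennreal (indicator {0..} x * f x) * indicator (- ages G) x = 0"
    by (subst (asm) nn_integral_0_iff_AE) auto
  then show ?thesis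
    by eventually_elim (use assms(4) in \<open>force simp: indicator_def ennreal_eq_0_iff split: if_splits\<close>)
qed

text \<open>At time 0 the function \<open>aged\<close> vanishes off the ages by construction, while
  the given densities may be nonzero there on a null set, so they agree only almost
  everywhere.\<close>

lemma initial_densities: "initial_densities Gs Gr qt0 b0 b qt q"
  unfolding initial_densities_def
proof (intro conjI allI impI)
  have "AE x in lborel. 0 \<le> x \<longrightarrow> x \<notin> ages Gs \<longrightarrow> b0 x = 0"
    using age_measure_\<nu>[of 0] has_age_density_age_law[OF \<nu>0 age_measureD(2)[OF age_measure_\<nu>]]
    by (intro initial_density_off_ages[OF s.lifetime_axioms] s.f0_integrable s.f0_nonneg) auto
  moreover have "AE x in lborel. 0 \<le> x \<longrightarrow> x \<notin> ages Gr \<longrightarrow> qt0 x = 0"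
    using age_measure_\<eta>[of 0] has_age_density_age_law[OF \<eta>0 age_measureD(2)[OF age_measure_\<eta>]]
    by (intro initial_density_off_ages[OF r.lifetime_axioms] r.f0_integrable r.f0_nonneg) auto
  \<comment> \<open>Almost everywhere \<open>q 0 \<le> qt 0\<close>, and both have mass
    \<open>queue X 0\<close>, so the nonnegative difference is null. The value of \<open>w 0\<close>
    need not be known.\<close>
  moreover have "AE x in lborel. 0 \<le> x \<longrightarrow> q 0 x = qt 0 x"
  proof -
    have i: "set_integrable lborel {0..} (\<lambda>x. qt 0 x - q 0 x)"
      by (intro set_integral_diff(1) qt_integrable q_integrable) auto
    have "(LINT x:{0..}|lborel. qt 0 x - q 0 x) = 0"
      using initial_queue mass_q[of 0] unfolding mass_def
      by (subst set_integral_diff(2)[OF qt_integrable q_integrable]) auto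
    moreover have "AE x in lborel. 0 \<le> indicator {0..} x *\<^sub>R (qt 0 x - q 0 x)"
      using AE_q[of 0] by eventually_elim (use qt_nonneg[of 0] in \<open>auto simp: indicator_def\<close>)
    ultimately have "AE x in lborel. indicator {0..} x *\<^sub>R (qt 0 x - q 0 x) = 0"
      using i unfolding set_lebesgue_integral_def set_integrable_def
      by (subst (asm) integral_nonneg_eq_0_iff_AE) auto
    then show ?thesis by eventually_elim (auto simp: indicator_def)
  qed
  ultimately show "AE x in lborel. 0 \<le> x \<longrightarrow> b 0 x = b0 x \<and> qt 0 x = qt0 x \<and> q 0 x = qt 0 x"
    using AE_lborel_singleton[of "0::real"]
  proof eventually_elim
    case (elim x)
    then show ?case
      using s.aged_0_pos[of x \<beta> b0] s.aged_eq_0[of x \<beta> b0 0] r.aged_0_pos[of x lam0 qt0] r.aged_eq_0[of x lam0 qt0 0]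
      by (cases "x \<in> ages Gs"; cases "x \<in> ages Gr") auto
  qed
  fix x :: real assume x: "0 \<le> x"
  show "x \<notin> ages Gs \<Longrightarrow> b 0 x = 0" by (rule s.aged_eq_0[OF x])
  show "x \<notin> ages Gr \<Longrightarrow> qt 0 x = 0" by (rule r.aged_eq_0[OF x])
  then show "x \<notin> ages Gr \<Longrightarrow> q 0 x = 0" using r.zero_in_ages by (auto simp: q_def)
qed

lemma queue_boundary: "queue_boundary qt q w"
  unfolding queue_boundary_def
proof (intro allI impI conjI)
  fix t :: real assume t: "0 \<le> t"
  show "0 \<le> w t" by (rule head_age_nonneg)
  have "w t = 0" if "queue X t = 0"
    using that by (intro head_age_empty_queue) (auto simp: queue_def max_def split: if_splits)
  \<comment> \<open>With a zero boundary only age 0 is waiting, and it carries no mass of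
    \<open>\<eta>\<^sub>t\<close>.\<close>
  moreover have "queue X t = 0" if "w t = 0"
  proof -
    have "{x. 0 \<le> x \<and> ereal x \<le> w t} = {0}" using that by auto
    then show ?thesis using measure_waiting[OF t] measure_\<eta>_0[OF t] by simp
  qed
  moreover have "0 \<le> queue X t" by (simp add: queue_def)
  ultimately show "(0 < w t) = (0 < mass (q t))"
    using head_age_nonneg[of t] by (auto simp: mass_q t less_le)
  have "{x. 0 \<le> x \<and> ereal x \<le> w t} = {0..} \<inter> {x. ereal x \<le> w t}" by auto
  then have "{x. 0 \<le> x \<and> ereal x \<le> w t} \<in> sets borel" by simp
  then show "(LINT x:{x. 0 \<le> x \<and> ereal x \<le> w t}|lborel. qt t x) = mass (q t)"
    using measure_\<eta>[OF t, of "{x. 0 \<le> x \<and> ereal x \<le> w t}"] measure_waiting[OF t]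
    by (simp add: mass_q t subset_eq)
next
  fix t x :: real assume "0 < x"
  then show "ereal x \<le> w t \<Longrightarrow> q t x = qt t x" "w t < ereal x \<Longrightarrow> q t x = 0"
    by (auto simp: q_def)
qed

text \<open>Since \<open>mass (b t)\<close> is \<open>min (X t) 1\<close> and
  \<open>mass (q t)\<close> is \<open>max (X t - 1) 0\<close>, the prescribed cases are exactly
  \<open>X t < 1\<close>, \<open>X t = 1\<close> and \<open>X t > 1\<close>, by which
  \<open>\<beta>\<close> and \<open>q t 0\<close> are defined.\<close>

lemma boundary_conditions: "boundary_conditions lam (hazard_flow Gs gs b) b qt q"
  unfolding boundary_conditions_def
proof (intro conjI allI impI)
  show "AE t in lborel. 0 \<le> t \<longrightarrow> hazard_flow Gs gs b t < \<infinity>"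
    using locally_integrable_rate_AE_finite[OF locally_integrable(1)] by eventually_elim (simp add: hazard_flow_b)
next
  fix t :: real assume t: "0 \<le> t"
  show "qt t 0 = lam t" using t by (simp add: r.aged_0_right lam0_def)
qed (auto simp: hazard_flow_b mass_b mass_q s.aged_0_right \<beta>_def q_def queue_def min_def max_def split: if_splits)

text \<open>This is the balance equation of the measure-valued model: \<open>K 0 = 0\<close>, the
  derivative \<open>\<beta>\<close> of \<open>K\<close> is \<open>b s 0\<close>, and the hazard flow
  of \<open>q\<close> is the reneging rate.\<close>

lemma flow_balance: "flow_balance lam (hazard_flow Gr gr q) b q"
  unfolding flow_balance_def
proof (intro conjI allI impI)
  have "hazard_flow Gr gr q \<in> borel_measurable (restrict_space borel {0..}) \<longleftrightarrow>
      \<rho> \<in> borel_measurable (restrict_space borel {0..})"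
    by (rule measurable_cong) (simp add: hazard_flow_q space_restrict_space)
  moreover have int: "(\<integral>\<^sup>+s\<in>{0..t}. hazard_flow Gr gr q s \<partial>lborel) = (\<integral>\<^sup>+s\<in>{0..t}. \<rho> s \<partial>lborel)" for t
    by (intro nn_integral_cong) (auto simp: indicator_def hazard_flow_q)
  ultimately show "locally_integrable_rate (hazard_flow Gr gr q)"
    using locally_integrable(2) by (simp add: locally_integrable_rate_def)
  fix t :: real assume t: "0 \<le> t"
  have \<beta>: "set_integrable lborel {0..t} \<beta>"
    by (rule indefinite_integral_integrable[OF indefinite_integral_service_entries])
  then show "set_integrable lborel {0..t} (\<lambda>s. b s 0)"
    by (subst set_integrable_cong[where f'=\<beta> and M'=lborel and A'="{0..t}"]) (auto simp: s.aged_0_right)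
  have "(LINT s:{0..t}|lborel. b s 0) = (LINT s:{0..t}|lborel. \<beta> s)"
    by (intro set_lebesgue_integral_cong) (auto simp: s.aged_0_right)
  moreover have "service_entries Gs gs \<nu> t = service_entries Gs gs \<nu> 0 + (LINT s:{0..t}|lborel. \<beta> s)"
    by (rule indefinite_integralD[OF indefinite_integral_service_entries t])
  moreover have "service_entries Gs gs \<nu> 0 = 0"
    using cumulative_0[of \<sigma>] by (simp add: service_entries_def \<sigma>_def)
  moreover have "cumulative (hazard_flow Gr gr q) t = cumulative \<rho> t"
    by (simp add: cumulative_def int)
  ultimately show "arrivals lam t + mass (q 0) =
      mass (q t) + (LINT s:{0..t}|lborel. b s 0) + cumulative (hazard_flow Gr gr q) t"
    using flow[OF t] by (simp add: mass_q t \<rho>_def)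
qed

lemma two_parameter:
  "two_parameter_fluid_model Gs gs Gr gr lam qt0 b0
     (\<lambda>t y. measure (\<nu> t) {0..y}) (\<lambda>t y. measure (\<eta> t) {0..y})
     (\<lambda>t y. measure (\<eta> t) {x. 0 \<le> x \<and> ereal x \<le> min (ereal y) (w t)})"
  unfolding two_parameter_fluid_model_def
proof (rule exI[of _ b], rule exI[of _ qt], rule exI[of _ q], intro conjI allI impI)
  show "age_density_family b" "age_density_family qt" "age_density_family q"
    unfolding age_density_family_def
    by (simp_all add: b_integrable b_nonneg qt_integrable qt_nonneg q_integrable q_nonneg)
  fix t y :: real assume t: "0 \<le> t" and y: "0 \<le> y"
  show "measure (\<nu> t) {0..y} = (LINT x:{0..y}|lborel. b t x)" by (rule measure_\<nu>[OF t]) auto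
  show "measure (\<eta> t) {0..y} = (LINT x:{0..y}|lborel. qt t x)" by (rule measure_\<eta>[OF t]) auto
  have "{x. 0 \<le> x \<and> ereal x \<le> min (ereal y) (w t)} = {0..y} \<inter> {x. ereal x \<le> w t}" by auto
  then show "measure (\<eta> t) {x. 0 \<le> x \<and> ereal x \<le> min (ereal y) (w t)} = (LINT x:{0..y}|lborel. q t x)"
    using integral_q[OF t, of "{0..y}"] by simp
  interpret M: finite_measure "\<nu> t" by (rule age_measureD(2)[OF age_measure_\<nu>[OF t]])
  have "measure (\<nu> t) {0..y} \<le> busy \<nu> t"
    unfolding busy_def using age_measureD(1)[OF age_measure_\<nu>[OF t]] by (intro M.finite_measure_mono) auto
  then show "measure (\<nu> t) {0..y} \<le> 1" using busy_eq[OF t] by simp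
qed (use queue_boundary in \<open>auto intro: initial_densities s.aging_aged r.aging_aged boundary_conditions flow_balance\<close>)

end

theorem proposition4p1:
  fixes Gs gs Gr gr lam X qt0 b0 :: "real \<Rightarrow> real"
    and \<eta> \<nu> :: "real \<Rightarrow> real measure"
  assumes "lifetime_law Gs gs" and "lifetime_law Gr gr" and "arrival_rate lam"
    and "measure_valued_fluid_model Gs gs Gr gr lam \<eta> \<nu> X"
    and "(\<eta> 0, \<nu> 0, X 0) \<in> initial_states Gr Gs"
    and "has_age_density (\<eta> 0) qt0" and "has_age_density (\<nu> 0) b0"
  shows "two_parameter_fluid_model Gs gs Gr gr lam qt0 b0
           (\<lambda>t y. measure (\<nu> t) {0..y})
           (\<lambda>t y. measure (\<eta> t) {0..y})
           (\<lambda>t y. measure (\<eta> t) {x. 0 \<le> x \<and> ereal x \<le> min (ereal y) (head_age Gr \<eta> X t)})"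
proof -
  interpret fluid_model Gs gs Gr gr lam X qt0 b0 \<eta> \<nu>
    by (rule fluid_model.intro) (fact assms)+
  show ?thesis by (rule two_parameter[unfolded w_def])
qed

end
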